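(* Let $A\subset\mathbb{R}^d$ be nonempty and compact and let $r_0>0$ be a differentiability point of $r\mapsto V_A(r)$. Then for any Borel set $\beta\subset N(A)$, $$\lim_{r\to r_0}S_A(r,\Pi_A^{-1}(\beta))=S_A(r_0,\Pi_A^{-1}(\beta)).$$
   Context: For nonempty compact $A\subset\mathbb{R}^d$ and $r>0$, let $A_r:=\{x\in\mathbb{R}^d: d(x,A)<r\}$, where $d(x,A)=\min_{y\in A}|x-y|$, let $V_A(r):=\lambda_d(A_r)$ ($\lambda_d$ Lebesgue measure), and let $S_A(r,\cdot):=\mathcal{H}^{d-1}(\partial A_r\cap\cdot)$, where $\mathcal{H}^{d-1}$ is $(d-1)$-dimensional Hausdorff measure. $\mathrm{Unp}(A)$ is the set of points in $\mathbb{R}^d$ having a unique nearest point in $A$, and $\pi_A:\mathrm{Unp}(A)\to A$ maps each such point to its unique nearest point in $A$. The (generalized) normal bundle $N(A)$ of $A$ consists of all pairs $(x,n)\in\partial A\times S^{d-1}$ such that $x+sn\in\mathrm{Unp}(A)$ and $\pi_A(x+sn)=x$ for some $s>0$. The map $\Pi_A:\mathrm{Unp}(A)\setminus A\to N(A)$ is defined by $\Pi_A(x):=\left(\pi_A(x),\frac{x-\pi_A(x)}{|x-\pi_A(x)|}\right)$. *)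

theory Defs
  imports "HOL-Analysis.Analysis"
begin

section \<open>Hausdorff measure\<close>

text \<open>The \<open>m\<close>-dimensional Hausdorff (outer) measure of an arbitrary set, normalized so that it
  agrees with Lebesgue measure in dimension \<open>m\<close>. The empty set is treated separately
  because \<open>0 ^ 0 = 1\<close>: for \<open>m = 0\<close> a nonempty set has weight \<open>1\<close>, the empty set weight \<open>0\<close>,
  and one obtains counting measure. The covering sets are required to be bounded since
  \<^const>\<open>diameter\<close> is only meaningful for bounded sets; finite covers are included,
  as covering sets may be empty.\<close>

definition hausdorff_weight :: "nat \<Rightarrow> 'a::metric_space set \<Rightarrow> ennreal" where
  "hausdorff_weight m U =
     (if U = {} then 0 else ennreal (unit_ball_vol (real m) * (diameter U / 2) ^ m))"

definition hausdorff_pre :: "nat \<Rightarrow> real \<Rightarrow> 'a::metric_space set \<Rightarrow> ennreal" where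
  "hausdorff_pre m \<delta> S =
     (INF U \<in> {U :: nat \<Rightarrow> 'a set. S \<subseteq> (\<Union>i. U i) \<and> (\<forall>i. bounded (U i) \<and> diameter (U i) \<le> \<delta>)}.
        \<Sum>i. hausdorff_weight m (U i))"

definition hausdorff :: "nat \<Rightarrow> 'a::metric_space set \<Rightarrow> ennreal" where
  "hausdorff m S = (SUP \<delta> \<in> {0<..}. hausdorff_pre m \<delta> S)"

section \<open>Parallel sets, their volume and surface area measure\<close>

definition parallel_set :: "'a::euclidean_space set \<Rightarrow> real \<Rightarrow> 'a set" where
  "parallel_set A r = {x. infdist x A < r}"

definition parallel_volume :: "'a::euclidean_space set \<Rightarrow> real \<Rightarrow> real" where
  "parallel_volume A r = measure lebesgue (parallel_set A r)"

definition surface_measure :: "'a::euclidean_space set \<Rightarrow> real \<Rightarrow> 'a set \<Rightarrow> ennreal" where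
  "surface_measure A r E = hausdorff (DIM('a) - 1) (frontier (parallel_set A r) \<inter> E)"

section \<open>Metric projection and normal bundle\<close>

definition Unp :: "'a::euclidean_space set \<Rightarrow> 'a set" where
  "Unp A = {x. \<exists>!y. y \<in> A \<and> (\<forall>z\<in>A. dist x y \<le> dist x z)}"

text \<open>On \<^const>\<open>Unp\<close>, the library function \<^const>\<open>closest_point\<close> is the metric projection;
  elsewhere its value is an arbitrary choice, so it is only used together with
  membership in \<^const>\<open>Unp\<close>.\<close>

definition normal_bundle :: "'a::euclidean_space set \<Rightarrow> ('a \<times> 'a) set" where
  "normal_bundle A =
     {(x, n). x \<in> frontier A \<and> n \<in> sphere 0 1 \<and>
        (\<exists>s>0. x + s *\<^sub>R n \<in> Unp A \<and> closest_point A (x + s *\<^sub>R n) = x)}"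

definition normal_proj :: "'a::euclidean_space set \<Rightarrow> 'a \<Rightarrow> 'a \<times> 'a" where
  "normal_proj A x =
     (closest_point A x, (x - closest_point A x) /\<^sub>R norm (x - closest_point A x))"

text \<open>The preimage of \<open>\<beta>\<close> under \<^const>\<open>normal_proj\<close>, regarded as a map with domain \<open>Unp A - A\<close>.\<close>

definition normal_proj_vimage :: "'a::euclidean_space set \<Rightarrow> ('a \<times> 'a) set \<Rightarrow> 'a set" where
  "normal_proj_vimage A \<beta> = {x \<in> Unp A - A. normal_proj A x \<in> \<beta>}"

end

theory Submission
  imports Defs
begin

text \<open>
  Every point at distance \<open>r\<close> from \<open>A\<close> is \<open>a + r n\<close> with \<open>a \<in> A\<close> and \<open>n\<close> a unit vector such that
  the ray from \<open>a\<close> in direction \<open>n\<close> has \<open>a\<close> as a nearest point at least up to distance \<open>r\<close>. Let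
  \<open>G R\<close> be the set of the pairs \<open>(a, n)\<close> whose ray survives up to distance \<open>R\<close>; it decreases in
  \<open>R\<close>. The set measured at radius \<open>r\<close> is the image, under \<open>(a, n) \<mapsto> a + r n\<close>, of the pairs in \<open>\<beta>\<close>
  that lie in \<open>G r\<close> and whose end point \<open>a + r n\<close> has only one nearest point. Two radii are compared
  by moving points along their rays. The metric projection is monotone, and this alone gives two
  Lipschitz bounds on pairs from \<open>G R\<close>: moving outward from distance \<open>u\<close> to \<open>R\<close> stretches by at
  most \<open>R / u\<close>, and moving inward from \<open>s < R\<close> to \<open>r\<close> stretches by at most \<open>(R - r) / (R - s)\<close>.
  If all rays survived to a fixed \<open>R > r\<^sub>0\<close>, both factors would tend to \<open>1\<close> as \<open>r \<rightarrow> r\<^sub>0\<close>, and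
  continuity would follow.

  It remains to see that the rays which end near \<open>r\<^sub>0\<close> carry little surface area, uniformly for
  radii slightly below or equal to \<open>r\<^sub>0\<close> (lemma \<open>ending_rays_hausdorff_small\<close>). Here the
  differentiability of the volume enters. Put \<open>s = r\<^sub>0 - 2h\<close>, \<open>t = r\<^sub>0 - h\<close>, \<open>R = r\<^sub>0 + h\<close>. Shrinking
  the shell \<open>R \<le> d(x, A) < t R / s\<close> along its rays by the factor \<open>s / R\<close> places it inside the shell
  \<open>s \<le> d(x, A) < t\<close>, multiplies its volume by at least \<open>(s / R) ^ DIM('a)\<close> (lemma
  \<open>emeasure_Lipschitz_image_le\<close>), and meets no ray that ends before \<open>R\<close>. As both shells have volume
  \<open>V' h + o(h)\<close>, only the volume \<open>o(h)\<close> is left for the rays that end between \<open>t\<close> and \<open>R\<close>. By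
  Eilenberg's inequality (lemma \<open>Eilenberg_level_set_bound\<close>) some level set of the distance function
  in this remainder, at a level between \<open>s\<close> and \<open>t\<close>, has area \<open>o(1)\<close>, and the outward Lipschitz bound
  carries this estimate to all radii in \<open>[r\<^sub>0 - h, r\<^sub>0]\<close>.

  Of Hausdorff measure the argument only uses monotonicity, finite subadditivity, the behaviour under
  Lipschitz maps, and Eilenberg's inequality, all of which hold for it as an outer measure.
\<close>

section \<open>Hausdorff measure of unions and Lipschitz images\<close>

lemma hausdorff_weight_empty [simp]: "hausdorff_weight m {} = 0"
  by (simp add: hausdorff_weight_def)

lemma hausdorff_pre_le:
  assumes "S \<subseteq> (\<Union>i. U i)" "\<And>i. bounded (U i)" "\<And>i. diameter (U i) \<le> \<delta>"
  shows "hausdorff_pre m \<delta> S \<le> (\<Sum>i. hausdorff_weight m (U i))"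
  unfolding hausdorff_pre_def by (rule INF_lower) (use assms in auto)

lemma hausdorff_pre_mono:
  assumes "S \<subseteq> T" "\<delta>' \<le> \<delta>"
  shows "hausdorff_pre m \<delta> S \<le> hausdorff_pre m \<delta>' T"
  unfolding hausdorff_pre_def by (rule INF_superset_mono) (use assms in \<open>auto intro: order_trans\<close>)

lemma hausdorff_mono: "S \<subseteq> T \<Longrightarrow> hausdorff m S \<le> hausdorff m T"
  unfolding hausdorff_def by (intro SUP_mono) (auto intro: hausdorff_pre_mono)

text \<open>Two covers are interleaved, one on the even and the other on the odd indices.\<close>

lemma hausdorff_pre_Un: "hausdorff_pre m \<delta> (S \<union> T) \<le> hausdorff_pre m \<delta> S + hausdorff_pre m \<delta> T"
proof -
  let ?C = "\<lambda>S. {U :: nat \<Rightarrow> 'a set. S \<subseteq> (\<Union>i. U i) \<and> (\<forall>i. bounded (U i) \<and> diameter (U i) \<le> \<delta>)}"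
  have *: "hausdorff_pre m \<delta> (S \<union> T) \<le> (\<Sum>i. hausdorff_weight m (U i)) + (\<Sum>i. hausdorff_weight m (V i))"
    if U: "U \<in> ?C S" and V: "V \<in> ?C T" for U V
  proof -
    define W where "W i = (if even i then U (i div 2) else V (i div 2))" for i :: nat
    have even: "W (2 * i) = U i" and odd: "W (Suc (2 * i)) = V i" for i by (simp_all add: W_def)
    have "S \<union> T \<subseteq> (\<Union>i. W i)"
      using U V by (auto simp: subset_iff) (metis even, metis odd)
    then have "hausdorff_pre m \<delta> (S \<union> T) \<le> (\<Sum>i. hausdorff_weight m (W i))"
      by (rule hausdorff_pre_le) (use U V in \<open>auto simp: W_def\<close>)
    also have "\<dots> \<le> (\<Sum>i. hausdorff_weight m (U i)) + (\<Sum>i. hausdorff_weight m (V i))"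
    proof (rule suminf_le_const)
      fix n
      have "(\<Sum>i<n. hausdorff_weight m (W i)) \<le> (\<Sum>i<2*n. hausdorff_weight m (W i))"
        by (rule sum_mono2) auto
      also have "\<dots> = (\<Sum>i<n. hausdorff_weight m (U i)) + (\<Sum>i<n. hausdorff_weight m (V i))"
        by (induction n) (simp_all add: even odd add_ac)
      also have "\<dots> \<le> (\<Sum>i. hausdorff_weight m (U i)) + (\<Sum>i. hausdorff_weight m (V i))"
        by (intro add_mono sum_le_suminf) auto
      finally show "(\<Sum>i<n. hausdorff_weight m (W i)) \<le> \<dots>" .
    qed auto
    finally show ?thesis .
  qed
  show ?thesis
  proof (rule ennreal_le_epsilon)
    fix e :: real assume "hausdorff_pre m \<delta> S + hausdorff_pre m \<delta> T < top" and e: "0 < e"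
    then have fin: "hausdorff_pre m \<delta> S \<noteq> top" "hausdorff_pre m \<delta> T \<noteq> top"
      by auto
    have near: "\<exists>U \<in> ?C Z. (\<Sum>i. hausdorff_weight m (U i)) < hausdorff_pre m \<delta> Z + ennreal (e/2)"
      if "hausdorff_pre m \<delta> Z \<noteq> top" for Z :: "'a set"
    proof -
      have "hausdorff_pre m \<delta> Z < hausdorff_pre m \<delta> Z + ennreal (e/2)"
        using that e by (simp add: ennreal_less_iff less_top)
      then show ?thesis
        unfolding hausdorff_pre_def[of m \<delta> Z] INF_less_iff .
    qed
    obtain U V where U: "U \<in> ?C S" "(\<Sum>i. hausdorff_weight m (U i)) < hausdorff_pre m \<delta> S + ennreal (e/2)"
      and V: "V \<in> ?C T" "(\<Sum>i. hausdorff_weight m (V i)) < hausdorff_pre m \<delta> T + ennreal (e/2)"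
      using near[OF fin(1)] near[OF fin(2)] by blast
    have "hausdorff_pre m \<delta> (S \<union> T)
        \<le> (hausdorff_pre m \<delta> S + ennreal (e/2)) + (hausdorff_pre m \<delta> T + ennreal (e/2))"
      using *[OF U(1) V(1)] add_mono[OF less_imp_le[OF U(2)] less_imp_le[OF V(2)]]
      by (rule order_trans)
    also have "\<dots> = hausdorff_pre m \<delta> S + hausdorff_pre m \<delta> T + (ennreal (e/2) + ennreal (e/2))"
      by (simp only: add_ac)
    also have "ennreal (e/2) + ennreal (e/2) = ennreal e"
      using e by (simp flip: ennreal_plus)
    finally show "hausdorff_pre m \<delta> (S \<union> T) \<le> hausdorff_pre m \<delta> S + hausdorff_pre m \<delta> T + ennreal e" .
  qed
qed

lemma hausdorff_Un: "hausdorff m (S \<union> T) \<le> hausdorff m S + hausdorff m T"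
  unfolding hausdorff_def[of m "S \<union> T"]
proof (rule SUP_least)
  fix \<delta> :: real assume "\<delta> \<in> {0<..}"
  then have "hausdorff_pre m \<delta> S \<le> hausdorff m S" "hausdorff_pre m \<delta> T \<le> hausdorff m T"
    by (auto simp: hausdorff_def intro: SUP_upper)
  then show "hausdorff_pre m \<delta> (S \<union> T) \<le> hausdorff m S + hausdorff m T"
    using hausdorff_pre_Un[of m \<delta> S T] by (meson add_mono order_trans)
qed

text \<open>The map \<open>g p \<mapsto> f p\<close> is Lipschitz on the image of \<open>g\<close>. Stating this through two parametrisations
  of the same index set avoids choosing an inverse of \<open>g\<close>; it will be used for the points at two
  different distances on the same family of rays.\<close>

lemma hausdorff_Lipschitz_le:
  fixes f :: "'i \<Rightarrow> 'a::real_normed_vector" and g :: "'i \<Rightarrow> 'b::metric_space"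
  assumes L: "L > 0"
    and lip: "\<And>p q. p \<in> P \<Longrightarrow> q \<in> P \<Longrightarrow> dist (f p) (f q) \<le> L * dist (g p) (g q)"
  shows "hausdorff m (f ` P) \<le> ennreal (L ^ m) * hausdorff m (g ` P)"
proof -
  have pre: "hausdorff_pre m (L * \<delta>) (f ` P) \<le> ennreal (L ^ m) * (\<Sum>i. hausdorff_weight m (U i))"
    if U: "g ` P \<subseteq> (\<Union>i. U i)" "\<And>i. bounded (U i)" "\<And>i. diameter (U i) \<le> \<delta>" for \<delta> U
  proof -
    define V where "V i = f ` {p \<in> P. g p \<in> U i}" for i :: nat
    have d0: "0 \<le> diameter (U i)" for i using U(2) by (rule diameter_ge_0)
    have dV: "dist x y \<le> L * diameter (U i)" if "x \<in> V i" "y \<in> V i" for x y i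
    proof -
      obtain p q where pq: "p \<in> P" "q \<in> P" "g p \<in> U i" "g q \<in> U i" "x = f p" "y = f q"
        using \<open>x \<in> V i\<close> \<open>y \<in> V i\<close> by (auto simp: V_def)
      have "dist x y \<le> L * dist (g p) (g q)" using lip pq by auto
      also have "\<dots> \<le> L * diameter (U i)"
        using L U(2) pq by (auto intro: diameter_bounded_bound)
      finally show ?thesis .
    qed
    have diam: "diameter (V i) \<le> L * diameter (U i)" for i
      by (rule diameter_le) (use dV[of _ i] L d0[of i] in \<open>auto simp: dist_norm\<close>)
    have bdd: "bounded (V i)" for i
      unfolding bounded_two_points using dV by blast
    have weight: "hausdorff_weight m (V i) \<le> ennreal (L ^ m) * hausdorff_weight m (U i)" for i
    proof (cases "V i = {}")
      case False
      then have "U i \<noteq> {}" by (auto simp: V_def)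
      have "unit_ball_vol m * (diameter (V i) / 2) ^ m
          \<le> unit_ball_vol m * (L * diameter (U i) / 2) ^ m"
        using diam[of i] diameter_ge_0[OF bdd, of i]
        by (intro mult_left_mono power_mono divide_right_mono) auto
      also have "\<dots> = L ^ m * (unit_ball_vol m * (diameter (U i) / 2) ^ m)"
        by (simp add: power_mult_distrib power_divide)
      finally show ?thesis
        using False \<open>U i \<noteq> {}\<close> L
        by (auto simp: hausdorff_weight_def ennreal_mult'[symmetric] intro!: ennreal_leI)
    qed simp
    have "f ` P \<subseteq> (\<Union>i. V i)" using U(1) by (fastforce simp: V_def)
    moreover have "diameter (V i) \<le> L * \<delta>" for i
      using diam[of i] mult_left_mono[OF U(3), of L i] L by linarith
    ultimately have "hausdorff_pre m (L * \<delta>) (f ` P) \<le> (\<Sum>i. hausdorff_weight m (V i))"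
      using bdd by (intro hausdorff_pre_le) auto
    also have "\<dots> \<le> (\<Sum>i. ennreal (L ^ m) * hausdorff_weight m (U i))"
      by (intro suminf_le weight) auto
    finally show ?thesis by simp
  qed
  show ?thesis
    unfolding hausdorff_def[of m "f ` P"]
  proof (rule SUP_least)
    fix \<epsilon> :: real assume "\<epsilon> \<in> {0<..}"
    define \<delta> where "\<delta> = \<epsilon> / L"
    have \<delta>: "\<delta> > 0" "L * \<delta> = \<epsilon>" using \<open>\<epsilon> \<in> {0<..}\<close> L by (auto simp: \<delta>_def)
    have c: "ennreal (L ^ m) \<noteq> 0" "ennreal (L ^ m) \<noteq> top" using L by auto
    have "hausdorff_pre m \<epsilon> (f ` P) / ennreal (L ^ m) \<le> hausdorff_pre m \<delta> (g ` P)"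
      unfolding hausdorff_pre_def[of m \<delta>]
      using pre[of _ \<delta>] \<delta> L by (intro INF_greatest divide_le_posI_ennreal) auto
    also have "\<dots> \<le> hausdorff m (g ` P)"
      unfolding hausdorff_def using \<delta> by (intro SUP_upper) auto
    finally have "ennreal (L ^ m) * (hausdorff_pre m \<epsilon> (f ` P) / ennreal (L ^ m))
        \<le> ennreal (L ^ m) * hausdorff m (g ` P)"
      by (rule mult_left_mono) auto
    then show "hausdorff_pre m \<epsilon> (f ` P) \<le> ennreal (L ^ m) * hausdorff m (g ` P)"
      using mult_divide_eq_ennreal[OF c, of "hausdorff_pre m \<epsilon> (f ` P)"]
      by (simp add: ennreal_times_divide mult.commute)
  qed
qed

section \<open>Volume of Lipschitz images and covers by small cubes\<close>

text \<open>Converts sums over a countable index set without a canonical order into series, allowing finite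
  and empty index sets: the value \<open>None\<close> fills the unused positions.\<close>

lemma countable_enumeration:
  assumes "countable D"
  obtains g :: "nat \<Rightarrow> 'b option"
  where "(\<Union>n. set_option (g n)) = D"
    and "\<And>w :: 'b \<Rightarrow> ennreal.
           (\<Sum>n. case g n of None \<Rightarrow> 0 | Some x \<Rightarrow> w x) = (\<integral>\<^sup>+x. w x \<partial>count_space D)"
proof
  define g where "g n = (if n \<in> to_nat_on D ` D then Some (from_nat_into D n) else None)" for n
  show "(\<Union>n. set_option (g n)) = D"
  proof (intro equalityI subsetI)
    fix x assume "x \<in> D"
    then have "x \<in> set_option (g (to_nat_on D x))" using assms by (simp add: g_def)
    then show "x \<in> (\<Union>n. set_option (g n))" by blast
  qed (use assms in \<open>auto simp: g_def split: if_splits\<close>)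
  fix w :: "'b \<Rightarrow> ennreal"
  have "(\<integral>\<^sup>+x. w x \<partial>count_space D)
      = (\<integral>\<^sup>+x. w (from_nat_into D (to_nat_on D x)) \<partial>count_space D)"
    by (intro nn_integral_cong) (use assms in auto)
  also have "\<dots> = (\<integral>\<^sup>+n. w (from_nat_into D n) \<partial>count_space (to_nat_on D ` D))"
    using nn_integral_bij_count_space[OF inj_on_imp_bij_betw[OF inj_on_to_nat_on[OF assms]],
        of "\<lambda>n. w (from_nat_into D n)"] .
  also have "\<dots> = (\<integral>\<^sup>+n. (case g n of None \<Rightarrow> 0 | Some x \<Rightarrow> w x) \<partial>count_space UNIV)"
    by (subst nn_integral_count_space_indicator)
       (auto intro!: nn_integral_cong simp: g_def indicator_def)
  finally show "(\<Sum>n. case g n of None \<Rightarrow> 0 | Some x \<Rightarrow> w x) = (\<integral>\<^sup>+x. w x \<partial>count_space D)"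
    by (simp add: nn_integral_count_space_nat)
qed

lemma emeasure_UN_le_nn_integral:
  assumes "countable D" "\<And>i. i \<in> D \<Longrightarrow> F i \<in> sets M"
  shows "emeasure M (\<Union>i\<in>D. F i) \<le> (\<integral>\<^sup>+i. emeasure M (F i) \<partial>count_space D)"
proof -
  obtain g where g: "(\<Union>n. set_option (g n)) = D"
    "\<And>w :: 'a \<Rightarrow> ennreal. (\<Sum>n. case g n of None \<Rightarrow> 0 | Some x \<Rightarrow> w x) = (\<integral>\<^sup>+x. w x \<partial>count_space D)"
    using countable_enumeration[OF assms(1)] by metis
  define B where "B n = (case g n of None \<Rightarrow> {} | Some i \<Rightarrow> F i)" for n
  have "(\<Union>i\<in>D. F i) = (\<Union>n. B n)"
    by (force simp: g(1)[symmetric] B_def split: option.splits)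
  moreover have "range B \<subseteq> sets M"
    using g(1) assms(2) by (force simp: B_def split: option.splits)
  moreover have "emeasure M (B n) = (case g n of None \<Rightarrow> 0 | Some i \<Rightarrow> emeasure M (F i))" for n
    by (simp add: B_def split: option.splits)
  ultimately show ?thesis
    using emeasure_subadditive_countably[of B M] g(2) by simp
qed

text \<open>The sharp constant \<open>L ^ d\<close> matters: later \<open>L\<close> tends to \<open>1\<close>, and a constant factor would destroy
  the comparison of derivatives. It is obtained by Vitali's theorem: up to a null set, which a
  Lipschitz map keeps null, \<open>S\<close> is covered by disjoint balls with centres in \<open>S\<close> inside an open set of
  almost the same measure, and each ball of radius \<open>r\<close> is mapped into a ball of radius \<open>L r\<close>.\<close>

lemma emeasure_Lipschitz_image_le:
  fixes f :: "'a::euclidean_space \<Rightarrow> 'a"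
  assumes S: "S \<in> sets lebesgue" and X: "X \<in> sets lebesgue" "X \<subseteq> f ` S" and L: "L > 0"
    and lip: "\<And>x y. x \<in> S \<Longrightarrow> y \<in> S \<Longrightarrow> dist (f x) (f y) \<le> L * dist x y"
  shows "emeasure lebesgue X \<le> ennreal (L ^ DIM('a)) * emeasure lebesgue S"
proof -
  have main: "emeasure lebesgue X \<le> ennreal (L ^ DIM('a)) * (emeasure lebesgue S + ennreal e)"
    if e: "e > 0" for e
  proof -
    obtain T where T: "open T" "S \<subseteq> T" "T - S \<in> lmeasurable" "emeasure lebesgue (T - S) < ennreal e"
      using sets_lebesgue_outer_open[OF S e] .
    define K where "K = {(x, r). x \<in> S \<and> r > 0 \<and> cball x r \<subseteq> T}"
    have ex: "\<exists>i. i \<in> K \<and> x \<in> cball (fst i) (snd i) \<and> snd i < d" if "x \<in> S" "0 < d" for x d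
    proof -
      obtain r where r: "r > 0" "cball x r \<subseteq> T"
        using T(1,2) \<open>x \<in> S\<close> open_contains_cball by blast
      have "cball x (min r (d/2)) \<subseteq> T" using r(2) by auto
      then have "(x, min r (d/2)) \<in> K" using that r by (auto simp: K_def)
      then show ?thesis using that r by (intro exI[of _ "(x, min r (d/2))"]) auto
    qed
    obtain C where C: "countable C" "C \<subseteq> K"
      "pairwise (\<lambda>i j. disjnt (cball (fst i) (snd i)) (cball (fst j) (snd j))) C"
      "negligible (S - (\<Union>i\<in>C. cball (fst i) (snd i)))"
    proof (rule Vitali_covering_theorem_cballs[of K snd S fst])
      show "\<And>i. i \<in> K \<Longrightarrow> 0 < snd i" by (auto simp: K_def)
    qed (use ex in blast)+
    define N where "N = S - (\<Union>i\<in>C. cball (fst i) (snd i))"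
    have "negligible (f ` N)"
    proof (rule negligible_locally_Lipschitz_image)
      show "negligible N" using C(4) by (simp add: N_def)
      fix x assume "x \<in> N"
      then show "\<exists>T B. open T \<and> x \<in> T \<and> (\<forall>y \<in> N \<inter> T. norm (f y - f x) \<le> B * norm (y - x))"
        using lip by (intro exI[of _ UNIV] exI[of _ L]) (auto simp: dist_norm N_def)
    qed simp
    then have nullN: "f ` N \<in> null_sets lebesgue" by (simp add: negligible_iff_null_sets)
    define W where "W = (\<Union>i\<in>C. cball (f (fst i)) (L * snd i))"
    have W: "W \<in> sets lebesgue"
      unfolding W_def using C(1) by (intro sets.countable_UN'') auto
    have "X \<subseteq> f ` N \<union> W"
    proof
      fix z assume "z \<in> X"
      then obtain x where x: "x \<in> S" "z = f x" using X by auto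
      show "z \<in> f ` N \<union> W"
      proof (cases "x \<in> N")
        case False
        then obtain i where i: "i \<in> C" "x \<in> cball (fst i) (snd i)"
          using x by (auto simp: N_def)
        then have "fst i \<in> S" using C(2) by (auto simp: K_def)
        then have "dist (f (fst i)) (f x) \<le> L * dist (fst i) x" using lip x by auto
        also have "\<dots> \<le> L * snd i" using i L by auto
        finally show ?thesis using i x by (auto simp: W_def)
      qed (use x in auto)
    qed
    then have "emeasure lebesgue X \<le> emeasure lebesgue (W \<union> f ` N)"
      using W nullN by (intro emeasure_mono) auto
    also have "\<dots> = emeasure lebesgue W"
      using W nullN by (rule emeasure_Un_null_set)
    also have "\<dots> \<le> (\<integral>\<^sup>+i. emeasure lebesgue (cball (f (fst i)) (L * snd i)) \<partial>count_space C)"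
      unfolding W_def using C(1) by (intro emeasure_UN_le_nn_integral) auto
    also have "\<dots> = (\<integral>\<^sup>+i. ennreal (L ^ DIM('a)) * emeasure lebesgue (cball (fst i) (snd i)) \<partial>count_space C)"
    proof (intro nn_integral_cong)
      fix i assume "i \<in> space (count_space C)"
      then have "snd i > 0" using C(2) by (auto simp: K_def)
      then show "emeasure lebesgue (cball (f (fst i)) (L * snd i)) =
          ennreal (L ^ DIM('a)) * emeasure lebesgue (cball (fst i) (snd i))"
        using L by (simp add: emeasure_cball power_mult_distrib ennreal_mult'[symmetric] mult_ac)
    qed
    also have "\<dots> = ennreal (L ^ DIM('a)) * emeasure lebesgue (\<Union>i\<in>C. cball (fst i) (snd i))"
    proof -
      have "disjoint_family_on (\<lambda>i. cball (fst i) (snd i)) C"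
        using C(3) by (auto simp: disjoint_family_on_def pairwise_def disjnt_def)
      then show ?thesis
        using C(1) by (subst emeasure_UN_countable) (auto simp: nn_integral_cmult)
    qed
    also have "emeasure lebesgue (\<Union>i\<in>C. cball (fst i) (snd i)) \<le> emeasure lebesgue T"
    proof (intro emeasure_mono)
      show "(\<Union>i\<in>C. cball (fst i) (snd i)) \<subseteq> T" using C(2) unfolding K_def by fastforce
    qed (use T(1) in auto)
    also have "emeasure lebesgue T = emeasure lebesgue (S \<union> (T - S))"
      using T(2) by (simp add: Un_absorb1)
    also have "\<dots> \<le> emeasure lebesgue S + emeasure lebesgue (T - S)"
      using S T(3) by (intro emeasure_subadditive) auto
    also have "\<dots> \<le> emeasure lebesgue S + ennreal e"
      using T(4) by (intro add_left_mono) auto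
    finally show ?thesis by (simp add: mult_left_mono)
  qed
  show ?thesis
  proof (rule ennreal_le_epsilon)
    fix e :: real assume e: "e > 0"
    have "e / L ^ DIM('a) > 0" using e L by simp
    from main[OF this] show "emeasure lebesgue X \<le> ennreal (L ^ DIM('a)) * emeasure lebesgue S + ennreal e"
      using L e by (simp add: distrib_left ennreal_mult'[symmetric])
  qed
qed

text \<open>A dyadic decomposition inside an open set of almost the same measure. Since the pieces are cubes,
  the \<open>d\<close>-th power of the diameter is a fixed multiple of the volume.\<close>

lemma cube_cover:
  fixes M :: "'a::euclidean_space set"
  assumes M: "M \<in> lmeasurable" "bounded M" and \<delta>: "\<delta> > 0" and e: "e > 0"
  obtains U :: "nat \<Rightarrow> 'a set"
  where "M \<subseteq> (\<Union>i. U i)" "\<And>i. bounded (U i)" "\<And>i. diameter (U i) \<le> \<delta>"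
    "(\<Sum>i. ennreal (diameter (U i) ^ DIM('a)))
       \<le> ennreal (sqrt (DIM('a)) ^ DIM('a)) * (emeasure lebesgue M + ennreal e)"
proof -
  let ?c = "sqrt (DIM('a)) ^ DIM('a)"
  obtain T where T: "open T" "M \<subseteq> T" "T - M \<in> lmeasurable" "emeasure lebesgue (T - M) < ennreal e"
    using sets_lebesgue_outer_open[OF fmeasurableD[OF M(1)] e] .
  obtain b where b: "M \<subseteq> cbox (- (\<Sum>i\<in>Basis. b *\<^sub>R i)) (\<Sum>i\<in>Basis. b *\<^sub>R i)" "b > 0"
  proof -
    obtain B where B: "\<And>x. x \<in> M \<Longrightarrow> norm x \<le> B" using M(2) by (auto simp: bounded_iff)
    have "M \<subseteq> cbox (- (\<Sum>i\<in>Basis. max B 1 *\<^sub>R i)) (\<Sum>i\<in>Basis. max B 1 *\<^sub>R i)"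
    proof
      fix x assume "x \<in> M"
      then have "\<bar>x \<bullet> i\<bar> \<le> max B 1" if "i \<in> Basis" for i
        using B[of x] Basis_le_norm[OF that, of x] by linarith
      then show "x \<in> cbox (- (\<Sum>i\<in>Basis. max B 1 *\<^sub>R i)) (\<Sum>i\<in>Basis. max B 1 *\<^sub>R i)"
        by (force simp: mem_box abs_le_iff minus_le_iff)
    qed
    then show thesis using that[of "max B 1"] by auto
  qed
  define v :: 'a where "v = (\<Sum>i\<in>Basis. b *\<^sub>R i)"
  have vi: "v \<bullet> i = b" if "i \<in> Basis" for i using that by (simp add: v_def)
  define g where "g x = (if x \<in> T then ball x (\<delta>/2) \<inter> T else ball x 1)" for x
  have g: "gauge g" using T(1) \<delta> by (auto simp: gauge_def g_def)
  have ne: "box (-v) v \<noteq> {}" using b(2) by (simp add: box_ne_empty vi)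
  have sub: "M \<subseteq> cbox (-v) v" using b(1) by (simp add: v_def)
  obtain D where D: "countable D"  "\<Union>D \<subseteq> cbox (-v) v"
    "\<And>K. K \<in> D \<Longrightarrow> interior K \<noteq> {} \<and> (\<exists>c d. K = cbox c d)"
    "pairwise (\<lambda>A B. interior A \<inter> interior B = {}) D"
    "\<And>K. K \<in> D \<Longrightarrow> \<exists>x \<in> M \<inter> K. K \<subseteq> g x"
    "\<And>p q. cbox p q \<in> D \<Longrightarrow> \<exists>n. \<forall>i \<in> Basis. q \<bullet> i - p \<bullet> i = (v \<bullet> i - (-v) \<bullet> i) / 2^n"
    "M \<subseteq> \<Union>D"
    by (rule covering_lemma[OF sub ne g]) (rule that; assumption)
  have Dprop: "bounded K \<and> diameter K \<le> \<delta> \<and> interior K \<subseteq> T \<and>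
      ennreal (diameter K ^ DIM('a)) = ennreal ?c * emeasure lebesgue (interior K)" if "K \<in> D" for K
  proof (intro conjI)
    obtain p q where K: "K = cbox p q" using D(3) \<open>K \<in> D\<close> by blast
    show "bounded K" by (simp add: K)
    obtain x where x: "x \<in> M" "K \<subseteq> g x" using D(5) \<open>K \<in> D\<close> by blast
    then have KT: "K \<subseteq> ball x (\<delta>/2)" "K \<subseteq> T" using T(2) by (auto simp: g_def split: if_splits)
    show "interior K \<subseteq> T" using KT(2) interior_subset by blast
    have "diameter K \<le> diameter (ball x (\<delta>/2))" using KT(1) by (intro diameter_subset) auto
    then show "diameter K \<le> \<delta>" using \<delta> by (simp add: diameter_ball)
    obtain n where n: "\<And>i. i \<in> Basis \<Longrightarrow> q \<bullet> i - p \<bullet> i = (v \<bullet> i - (-v) \<bullet> i) / 2^n"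
      using D(6) \<open>K \<in> D\<close> K by blast
    define l where "l = 2 * b / 2^n"
    have l: "q \<bullet> i - p \<bullet> i = l" if "i \<in> Basis" for i using n[OF that] by (simp add: l_def vi that)
    have l0: "l > 0" using b(2) by (simp add: l_def)
    have ple: "p \<bullet> i \<le> q \<bullet> i" if "i \<in> Basis" for i using l[OF that] l0 by simp
    have "dist p q = sqrt (\<Sum>i\<in>Basis. (dist (p \<bullet> i) (q \<bullet> i))\<^sup>2)"
      by (simp add: euclidean_dist_l2[of p q] L2_set_def)
    also have "(\<Sum>i\<in>Basis. (dist (p \<bullet> i) (q \<bullet> i))\<^sup>2) = (\<Sum>i\<in>(Basis::'a set). l\<^sup>2)"
    proof (intro sum.cong refl)
      fix i :: 'a assume "i \<in> Basis"
      then show "(dist (p \<bullet> i) (q \<bullet> i))\<^sup>2 = l\<^sup>2"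
        using l[of i] power2_commute[of "p \<bullet> i" "q \<bullet> i"] by (simp add: dist_real_def)
    qed
    also have "sqrt \<dots> = sqrt (DIM('a)) * l" using l0 by (simp add: real_sqrt_mult)
    finally have "diameter K = sqrt (DIM('a)) * l" using ple by (simp add: K diameter_cbox)
    moreover have "emeasure lebesgue (interior K) = ennreal (l ^ DIM('a))"
      using ple l by (simp add: K interior_cbox emeasure_lborel_box inner_diff_left)
    ultimately show "ennreal (diameter K ^ DIM('a)) = ennreal ?c * emeasure lebesgue (interior K)"
      using l0 by (simp add: power_mult_distrib ennreal_mult')
  qed
  obtain h where h: "(\<Union>n. set_option (h n)) = D"
    "\<And>w :: 'a set \<Rightarrow> ennreal. (\<Sum>n. case h n of None \<Rightarrow> 0 | Some x \<Rightarrow> w x) = (\<integral>\<^sup>+x. w x \<partial>count_space D)"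
    using countable_enumeration[OF D(1)] by metis
  define U where "U n = (case h n of None \<Rightarrow> {} | Some K \<Rightarrow> K)" for n
  have U: "U n = {} \<or> U n \<in> D" for n
    using h(1) by (force simp: U_def split: option.splits)
  show thesis
  proof
    have "\<exists>n. K = U n" if "K \<in> D" for K
    proof -
      obtain n where "h n = Some K" using \<open>K \<in> D\<close> h(1) by (metis UN_E elem_set)
      then have "U n = K" by (simp add: U_def)
      then show ?thesis by blast
    qed
    then have "D \<subseteq> range U" by auto
    then show "M \<subseteq> (\<Union>i. U i)" using D(7) Union_mono by (meson order_trans)
    show "bounded (U i)" "diameter (U i) \<le> \<delta>" for i
      using U[of i] Dprop[of "U i"] \<delta> by auto
    have "(\<Sum>i. ennreal (diameter (U i) ^ DIM('a)))
        = (\<Sum>n. case h n of None \<Rightarrow> 0 | Some K \<Rightarrow> ennreal (diameter K ^ DIM('a)))"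
      by (intro suminf_cong) (simp add: U_def split: option.splits)
    also have "\<dots> = (\<integral>\<^sup>+K. ennreal (diameter K ^ DIM('a)) \<partial>count_space D)"
      by (rule h(2))
    also have "\<dots> = (\<integral>\<^sup>+K. ennreal ?c * emeasure lebesgue (interior K) \<partial>count_space D)"
      by (intro nn_integral_cong) (use Dprop in auto)
    also have "\<dots> = ennreal ?c * (\<integral>\<^sup>+K. emeasure lebesgue (interior K) \<partial>count_space D)"
      by (simp add: nn_integral_cmult)
    also have "(\<integral>\<^sup>+K. emeasure lebesgue (interior K) \<partial>count_space D)
        = emeasure lebesgue (\<Union>K\<in>D. interior K)"
      by (rule emeasure_UN_countable[symmetric])
         (use D(1,4) in \<open>auto simp: disjoint_family_on_def pairwise_def\<close>)
    also have "\<dots> \<le> emeasure lebesgue T"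
      using Dprop T(1) by (intro emeasure_mono) auto
    also have "emeasure lebesgue T = emeasure lebesgue (M \<union> (T - M))"
      using T(2) by (simp add: Un_absorb1)
    also have "\<dots> \<le> emeasure lebesgue M + emeasure lebesgue (T - M)"
      using M T(3) by (intro emeasure_subadditive) auto
    also have "\<dots> \<le> emeasure lebesgue M + ennreal e"
      using T(4) by (intro add_left_mono) auto
    finally show "(\<Sum>i. ennreal (diameter (U i) ^ DIM('a)))
       \<le> ennreal ?c * (emeasure lebesgue M + ennreal e)" by (simp add: mult_left_mono)
  qed
qed

section \<open>Eilenberg inequality\<close>

text \<open>If \<open>M\<close> is covered by sets \<open>U\<^sub>i\<close>, then the level set at \<open>u\<close> is covered by those \<open>U\<^sub>i\<close> on which \<open>f\<close> takes
  the value \<open>u\<close>, and for each \<open>i\<close> such \<open>u\<close> fill an interval of length at most twice the diameter of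
  \<open>U\<^sub>i\<close>. Integrating the weights over \<open>u\<close> therefore adds one power of the diameter and leads from
  dimension \<open>d - 1\<close> to \<open>d\<close>, where covers by cubes compare with the volume. Measurability of the area
  of the level sets as a function of \<open>u\<close> is avoided, because the integrated functions are the explicit
  step sums coming from the covers.\<close>

lemma Eilenberg_level_set_bound:
  fixes M :: "'a::euclidean_space set" and f :: "'a \<Rightarrow> real"
  assumes M: "M \<in> lmeasurable" "bounded M"
    and f: "\<And>x y. \<bar>f x - f y\<bar> \<le> dist x y"
    and c: "\<And>u. s < u \<Longrightarrow> u < t \<Longrightarrow> c \<le> hausdorff (DIM('a) - 1) {x \<in> M. f x = u}"
  shows "c * ennreal (t - s)
    \<le> ennreal (4 * unit_ball_vol (DIM('a) - 1) / 2 ^ DIM('a) * sqrt (DIM('a)) ^ DIM('a)) * emeasure lebesgue M"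
proof -
  define m where "m = DIM('a) - 1"
  have d: "DIM('a) = Suc m" using DIM_positive[where 'a='a] by (simp add: m_def)
  define K1 where "K1 = 4 * unit_ball_vol m / 2 ^ Suc m"
  define K2 where "K2 = sqrt (DIM('a)) ^ DIM('a)"
  have K0: "K1 \<ge> 0" "K2 \<ge> 0" by (auto simp: K1_def K2_def)
  define e where "e k = inverse (real (Suc k))" for k
  have e: "e k > 0" for k by (simp add: e_def)
  have "\<forall>k. \<exists>U :: nat \<Rightarrow> 'a set. M \<subseteq> (\<Union>i. U i) \<and> (\<forall>i. bounded (U i)) \<and> (\<forall>i. diameter (U i) \<le> e k) \<and>
      (\<Sum>i. ennreal (diameter (U i) ^ DIM('a))) \<le> ennreal K2 * (emeasure lebesgue M + ennreal (e k))"
  proof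
    fix k
    show "\<exists>U :: nat \<Rightarrow> 'a set. M \<subseteq> (\<Union>i. U i) \<and> (\<forall>i. bounded (U i)) \<and> (\<forall>i. diameter (U i) \<le> e k) \<and>
      (\<Sum>i. ennreal (diameter (U i) ^ DIM('a))) \<le> ennreal K2 * (emeasure lebesgue M + ennreal (e k))"
      using cube_cover[OF M e[of k] e[of k]] unfolding K2_def by metis
  qed
  then obtain U :: "nat \<Rightarrow> nat \<Rightarrow> 'a set" where
    U: "\<And>k. M \<subseteq> (\<Union>i. U k i)" "\<And>k i. bounded (U k i)" "\<And>k i. diameter (U k i) \<le> e k"
    "\<And>k. (\<Sum>i. ennreal (diameter (U k i) ^ DIM('a))) \<le> ennreal K2 * (emeasure lebesgue M + ennreal (e k))"
    by metis
  \<comment> \<open>The interval around one value of \<open>f\<close> on \<open>U k i\<close> is symmetric, which costs a factor \<open>2\<close>. For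
    empty \<open>U k i\<close> it is a single point whose position is irrelevant.\<close>
  define J where "J k i = (let z = f (SOME x. x \<in> U k i); r = diameter (U k i) in {z - r .. z + r})" for k i
  have J: "f x \<in> J k i" if "x \<in> U k i" for x k i
  proof -
    have "(SOME x. x \<in> U k i) \<in> U k i" using that by (rule someI)
    then have "dist x (SOME x. x \<in> U k i) \<le> diameter (U k i)"
      using U(2) that by (intro diameter_bounded_bound)
    then show ?thesis
      using f[of x "SOME x. x \<in> U k i"] by (simp add: J_def Let_def abs_le_iff)
  qed
  \<comment> \<open>\<open>G k u\<close> is the total weight of the cover of the level set at \<open>u\<close> by the \<open>k\<close>-th family of cubes.\<close>
  define G where "G k u = (\<Sum>i. hausdorff_weight m (U k i) * indicator (J k i) u)" for k u
  have pre: "hausdorff_pre m (e k) {x \<in> M. f x = u} \<le> G k u" for k u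
  proof -
    let ?V = "\<lambda>i. if u \<in> J k i then U k i else {}"
    have "{x \<in> M. f x = u} \<subseteq> (\<Union>i. ?V i)" using U(1)[of k] J by fastforce
    then have "hausdorff_pre m (e k) {x \<in> M. f x = u} \<le> (\<Sum>i. hausdorff_weight m (?V i))"
      by (rule hausdorff_pre_le) (use U(2,3) less_imp_le[OF e] in auto)
    also have "\<dots> = G k u"
      unfolding G_def by (intro suminf_cong) (auto simp: indicator_def)
    finally show ?thesis .
  qed
  have int_G: "(\<integral>\<^sup>+u. G k u \<partial>lborel) \<le> ennreal (K1 * K2) * (emeasure lebesgue M + ennreal (e k))" for k
  proof -
    have "(\<integral>\<^sup>+u. G k u \<partial>lborel) = (\<Sum>i. \<integral>\<^sup>+u. hausdorff_weight m (U k i) * indicator (J k i) u \<partial>lborel)"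
      unfolding G_def by (rule nn_integral_suminf) (simp add: J_def Let_def)
    also have "\<dots> \<le> (\<Sum>i. ennreal K1 * ennreal (diameter (U k i) ^ DIM('a)))"
    proof (intro suminf_le)
      fix i
      let ?r = "diameter (U k i)"
      have r: "?r \<ge> 0" using U(2) by (rule diameter_ge_0)
      have "(\<integral>\<^sup>+u. hausdorff_weight m (U k i) * indicator (J k i) u \<partial>lborel)
          = hausdorff_weight m (U k i) * ennreal (2 * ?r)"
        using r by (simp add: nn_integral_cmult_indicator J_def Let_def)
      also have "\<dots> \<le> ennreal (unit_ball_vol m * (?r / 2) ^ m) * ennreal (2 * ?r)"
        by (intro mult_right_mono) (auto simp: hausdorff_weight_def)
      also have "\<dots> = ennreal K1 * ennreal (?r ^ DIM('a))"
        using r K0 by (simp add: ennreal_mult'[symmetric] K1_def d power_divide field_simps)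
      finally show "(\<integral>\<^sup>+u. hausdorff_weight m (U k i) * indicator (J k i) u \<partial>lborel)
          \<le> ennreal K1 * ennreal (?r ^ DIM('a))" .
    qed auto
    also have "\<dots> = ennreal K1 * (\<Sum>i. ennreal (diameter (U k i) ^ DIM('a)))"
      by (rule ennreal_suminf_cmult)
    also have "\<dots> \<le> ennreal K1 * (ennreal K2 * (emeasure lebesgue M + ennreal (e k)))"
      by (intro mult_left_mono U(4)) auto
    finally show ?thesis using K0 by (simp add: ennreal_mult mult.assoc)
  qed
  have limG: "c \<le> liminf (\<lambda>k. G k u)" if u: "s < u" "u < t" for u
  proof -
    have "hausdorff m {x \<in> M. f x = u} \<le> liminf (\<lambda>k. G k u)"
      unfolding hausdorff_def
    proof (rule SUP_least)
      fix \<delta> :: real assume "\<delta> \<in> {0<..}"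
      then have "\<forall>\<^sub>F k in sequentially. e k < \<delta>"
        using LIMSEQ_inverse_real_of_nat order_tendstoD(2)[of e 0 sequentially \<delta>]
        by (auto simp: e_def[abs_def])
      then show "hausdorff_pre m \<delta> {x \<in> M. f x = u} \<le> liminf (\<lambda>k. G k u)"
        by (intro Liminf_bounded) (auto elim!: eventually_mono
            intro: order_trans[OF hausdorff_pre_mono[OF order_refl less_imp_le] pre])
    qed
    then show ?thesis using c[OF u] by (simp add: m_def)
  qed
  have meas: "G k \<in> borel_measurable lborel" for k
    unfolding G_def[abs_def] J_def Let_def by measurable
  have "c * ennreal (t - s) \<le> (\<integral>\<^sup>+u. c * indicator {s<..<t} u \<partial>lborel)"
    by (cases "s \<le> t") (simp_all add: nn_integral_cmult_indicator ennreal_neg)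
  also have "\<dots> \<le> (\<integral>\<^sup>+u. liminf (\<lambda>k. G k u) \<partial>lborel)"
    by (intro nn_integral_mono) (auto simp: limG indicator_def)
  also have "\<dots> \<le> liminf (\<lambda>k. \<integral>\<^sup>+u. G k u \<partial>lborel)"
    by (intro nn_integral_liminf meas)
  also have "\<dots> \<le> liminf (\<lambda>k. ennreal (K1 * K2) * (emeasure lebesgue M + ennreal (e k)))"
    by (intro Liminf_mono) (simp add: int_G)
  also have "\<dots> = ennreal (K1 * K2) * (emeasure lebesgue M + ennreal 0)"
  proof (intro lim_imp_Liminf)
    have "e \<longlonglongrightarrow> 0" using LIMSEQ_inverse_real_of_nat by (simp add: e_def[abs_def])
    then show "(\<lambda>k. ennreal (K1 * K2) * (emeasure lebesgue M + ennreal (e k)))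
        \<longlonglongrightarrow> ennreal (K1 * K2) * (emeasure lebesgue M + ennreal 0)"
      by (intro ennreal_tendsto_cmult tendsto_add tendsto_const tendsto_ennrealI) auto
  qed auto
  finally show ?thesis by (simp add: K1_def K2_def d[symmetric] m_def)
qed

section \<open>Rays normal to a compact set\<close>

text \<open>The pairs whose ray keeps its starting point as a nearest point of \<open>A\<close> up to distance \<open>R\<close>. The nearest
  point at distance exactly \<open>R\<close> need not be unique.\<close>

definition normals_reaching :: "'a::euclidean_space set \<Rightarrow> real \<Rightarrow> ('a \<times> 'a) set" where
  "normals_reaching A R = {(a, n). a \<in> A \<and> norm n = 1 \<and> infdist (a + R *\<^sub>R n) A = R}"

definition ray_point :: "real \<Rightarrow> 'a::real_vector \<times> 'a \<Rightarrow> 'a" where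
  "ray_point u p = fst p + u *\<^sub>R snd p"

lemma infdist_attained:
  fixes A :: "'a::euclidean_space set"
  assumes "compact A" "A \<noteq> {}"
  obtains a where "a \<in> A" "dist x a = infdist x A"
  by (rule setdist_attains_inf[OF assms, of "{x}"])
     (use that in \<open>auto simp: infdist_eq_setdist dist_commute\<close>)

lemma normals_reaching_antimono:
  assumes "0 \<le> R'" "R' \<le> R"
  shows "normals_reaching A R \<subseteq> normals_reaching A R'"
proof (clarsimp simp: normals_reaching_def)
  fix a n assume a: "a \<in> A" "norm n = 1" "infdist (a + R *\<^sub>R n) A = R"
  have "R \<le> infdist (a + R' *\<^sub>R n) A + dist (a + R *\<^sub>R n) (a + R' *\<^sub>R n)"
    using infdist_triangle[of "a + R *\<^sub>R n" A "a + R' *\<^sub>R n"] a by simp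
  also have "dist (a + R *\<^sub>R n) (a + R' *\<^sub>R n) = R - R'"
    using a assms by (simp add: dist_norm flip: scaleR_left_diff_distrib)
  finally have "R' \<le> infdist (a + R' *\<^sub>R n) A" by simp
  moreover have "infdist (a + R' *\<^sub>R n) A \<le> R'"
    using infdist_le[OF a(1), of "a + R' *\<^sub>R n"] a(2) assms by (simp add: dist_norm)
  ultimately show "infdist (a + R' *\<^sub>R n) A = R'" by simp
qed

lemma infdist_ray_point:
  "p \<in> normals_reaching A R \<Longrightarrow> 0 \<le> u \<Longrightarrow> u \<le> R \<Longrightarrow> infdist (ray_point u p) A = u"
  using normals_reaching_antimono[of u R A] by (force simp: normals_reaching_def ray_point_def)

lemma dist_ray_point:
  "p \<in> normals_reaching A R \<Longrightarrow> 0 \<le> u \<Longrightarrow> dist (ray_point u p) (fst p) = u"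
  by (auto simp: normals_reaching_def ray_point_def dist_norm)

text \<open>Metric projections onto arbitrary sets are monotone (they are selections from the subdifferential
  of the convex function \<open>(|x|\<^sup>2 - d(x, A)\<^sup>2) / 2\<close>). All Lipschitz estimates below come from this.\<close>

lemma nearest_point_monotone:
  fixes A :: "'a::euclidean_space set"
  assumes "a \<in> A" "dist x a = infdist x A" "b \<in> A" "dist y b = infdist y A"
  shows "0 \<le> (a - b) \<bullet> (x - y)"
proof -
  have "(norm (x - a))\<^sup>2 \<le> (norm (x - b))\<^sup>2" "(norm (y - b))\<^sup>2 \<le> (norm (y - a))\<^sup>2"
    using assms infdist_le[of b A x] infdist_le[of a A y]
    by (auto simp: dist_norm infdist_nonneg intro!: power_mono)
  then show ?thesis
    by (simp add: power2_norm_eq_inner inner_diff_left inner_diff_right inner_commute)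
qed

lemma norm_add_scaleR_mono:
  fixes v w :: "'a::real_inner"
  assumes "0 \<le> v \<bullet> w" "0 \<le> \<alpha>" "0 \<le> b" "b \<le> c"
  shows "norm (\<alpha> *\<^sub>R v + b *\<^sub>R w) \<le> norm (\<alpha> *\<^sub>R v + c *\<^sub>R w)"
proof -
  have "2 * \<alpha> * b * (v \<bullet> w) \<le> 2 * \<alpha> * c * (v \<bullet> w)"
    using assms by (intro mult_right_mono mult_left_mono) auto
  moreover have "b\<^sup>2 * (w \<bullet> w) \<le> c\<^sup>2 * (w \<bullet> w)"
    using assms by (intro mult_right_mono power_mono) auto
  moreover have "(norm (\<alpha> *\<^sub>R v + x *\<^sub>R w))\<^sup>2
      = \<alpha>\<^sup>2 * (v \<bullet> v) + 2 * \<alpha> * x * (v \<bullet> w) + x\<^sup>2 * (w \<bullet> w)" for x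
    unfolding power2_norm_eq_inner
    by (simp add: inner_add_left inner_add_right inner_commute power2_eq_square algebra_simps)
  ultimately have "(norm (\<alpha> *\<^sub>R v + b *\<^sub>R w))\<^sup>2 \<le> (norm (\<alpha> *\<^sub>R v + c *\<^sub>R w))\<^sup>2"
    by simp
  then show ?thesis by (rule power2_le_imp_le) simp
qed

lemma normals_reaching_monotone:
  assumes "p \<in> normals_reaching A R" "q \<in> normals_reaching A R" "0 \<le> R"
  shows "0 \<le> (fst p - fst q) \<bullet> (ray_point R p - ray_point R q)"
  using assms dist_ray_point[of p A R R] dist_ray_point[of q A R R]
    infdist_ray_point[of p A R R] infdist_ray_point[of q A R R]
  by (intro nearest_point_monotone[of _ A]) (auto simp: normals_reaching_def)

text \<open>With \<open>v\<close> and \<open>w\<close> the differences of the foot points and of the points at distance \<open>R\<close>, the points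
  at distance \<open>u\<close> differ by \<open>(1 - u / R) v + (u / R) w\<close>, and \<open>v \<bullet> w \<ge> 0\<close>.\<close>

lemma ray_point_outward_Lipschitz:
  assumes p: "p \<in> normals_reaching A R" and q: "q \<in> normals_reaching A R" and u: "0 < u" "u \<le> R"
  shows "dist (ray_point R p) (ray_point R q) \<le> R / u * dist (ray_point u p) (ray_point u q)"
proof -
  define v w where "v = fst p - fst q" and "w = ray_point R p - ray_point R q"
  have vw: "0 \<le> w \<bullet> v"
    using normals_reaching_monotone[OF p q] u by (simp add: v_def w_def inner_commute)
  have "norm (1 *\<^sub>R w + 0 *\<^sub>R v) \<le> norm (1 *\<^sub>R w + ((R - u) / u) *\<^sub>R v)"
    using vw u by (intro norm_add_scaleR_mono) auto
  also have "1 *\<^sub>R w + ((R - u) / u) *\<^sub>R v = (R / u) *\<^sub>R (ray_point u p - ray_point u q)"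
    using u by (simp add: v_def w_def ray_point_def algebra_simps diff_divide_distrib)
  finally show ?thesis using u by (simp add: w_def dist_norm)
qed

text \<open>On points with \<open>s = R\<close> the projection is in general not Lipschitz, and the constant has to blow up
  there; for rays that survive beyond \<open>s\<close> it is finite and tends to \<open>1\<close> as \<open>r\<close> approaches \<open>s\<close>.\<close>

lemma ray_point_inward_Lipschitz:
  assumes p: "p \<in> normals_reaching A R" and q: "q \<in> normals_reaching A R"
    and r: "0 \<le> r" "r \<le> s" "s < R"
  shows "dist (ray_point r p) (ray_point r q)
    \<le> (R - r) / (R - s) * dist (ray_point s p) (ray_point s q)"
proof -
  define v w where "v = fst p - fst q" and "w = ray_point R p - ray_point R q"
  have vw: "0 \<le> v \<bullet> w"
    using normals_reaching_monotone[OF p q] r by (simp add: v_def w_def)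
  have pos: "R > 0" "R - s > 0" using r by auto
  have diff: "ray_point u p - ray_point u q = (1 - u / R) *\<^sub>R v + (u / R) *\<^sub>R w" for u
    using pos by (simp add: v_def w_def ray_point_def algebra_simps)
  have "norm ((1 - r / R) *\<^sub>R v + (r / R) *\<^sub>R w)
      \<le> norm ((1 - r / R) *\<^sub>R v + ((R - r) / (R - s) * (s / R)) *\<^sub>R w)"
  proof (intro norm_add_scaleR_mono vw)
    have "r * (R - s) \<le> s * (R - r)" using r by (simp add: algebra_simps mult_right_mono)
    then show "r / R \<le> (R - r) / (R - s) * (s / R)" using pos by (simp add: field_simps)
  qed (use r pos in auto)
  then have "norm (ray_point r p - ray_point r q)
      \<le> norm ((1 - r / R) *\<^sub>R v + ((R - r) / (R - s) * (s / R)) *\<^sub>R w)"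
    by (simp only: diff)
  also have "1 - r / R = (R - r) / (R - s) * (1 - s / R)" using pos by (simp add: field_simps)
  also have "((R - r) / (R - s) * (1 - s / R)) *\<^sub>R v + ((R - r) / (R - s) * (s / R)) *\<^sub>R w
      = ((R - r) / (R - s)) *\<^sub>R (ray_point s p - ray_point s q)"
    by (simp only: diff scaleR_add_right scaleR_scaleR)
  finally show ?thesis using r by (simp add: dist_norm)
qed

text \<open>Another nearest point \<open>b\<close> at distance \<open>u\<close> would have distance at most \<open>R\<close> from the point at
  distance \<open>R\<close>; equality in the triangle inequality forces \<open>b\<close> onto the ray.\<close>

lemma ray_point_unique_nearest:
  fixes A :: "'a::euclidean_space set"
  assumes p: "p \<in> normals_reaching A R" and u: "0 \<le> u" "u < R"
    and b: "b \<in> A" "dist (ray_point u p) b = u"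
  shows "b = fst p"
proof -
  have n: "norm (snd p) = 1" using p by (auto simp: normals_reaching_def)
  let ?y = "ray_point u p - b"
  have y: "norm ?y = u" using b(2) by (simp add: dist_norm)
  have z: "norm ((R - u) *\<^sub>R snd p) = R - u" using n u by simp
  have sum: "?y + (R - u) *\<^sub>R snd p = ray_point R p - b"
    by (simp add: ray_point_def algebra_simps)
  have "R \<le> norm (?y + (R - u) *\<^sub>R snd p)"
    using infdist_le[OF b(1), of "ray_point R p"] infdist_ray_point[OF p, of R] u
    by (simp add: sum dist_norm)
  then have "norm (?y + (R - u) *\<^sub>R snd p) = norm ?y + norm ((R - u) *\<^sub>R snd p)"
    using norm_triangle_ineq[of ?y "(R - u) *\<^sub>R snd p"] y z by linarith
  then have "norm ?y *\<^sub>R ((R - u) *\<^sub>R snd p) = norm ((R - u) *\<^sub>R snd p) *\<^sub>R ?y"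
    by (simp only: norm_triangle_eq)
  then have "(R - u) *\<^sub>R (u *\<^sub>R snd p) = (R - u) *\<^sub>R ?y"
    by (simp only: y z) (simp add: mult.commute)
  then have "u *\<^sub>R snd p = ?y" using u by (simp only: scaleR_cancel_left) simp
  then show ?thesis by (simp add: ray_point_def)
qed

lemma ray_point_eqD:
  assumes p: "p \<in> normals_reaching A R" and u: "0 < u" "u < R"
    and q: "q \<in> normals_reaching A u" and eq: "ray_point u p = ray_point u q"
  shows "p = q"
proof -
  have "fst q = fst p"
    using q eq u dist_ray_point[OF q, of u]
    by (intro ray_point_unique_nearest[OF p]) (auto simp: normals_reaching_def)
  then show ?thesis using eq u by (auto simp: ray_point_def prod_eq_iff)
qed

lemma normals_reaching_nearest:
  assumes "a \<in> A" "dist x a = infdist x A" "infdist x A > 0"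
  shows "(a, (x - a) /\<^sub>R infdist x A) \<in> normals_reaching A (infdist x A)"
  using assms by (simp add: normals_reaching_def dist_norm)

lemma open_parallel_set: "open (parallel_set A r)"
  unfolding parallel_set_def by (intro open_Collect_less continuous_intros)

lemma bounded_parallel_set:
  assumes "compact A" "A \<noteq> {}"
  shows "bounded (parallel_set A r)"
proof (rule bounded_subset)
  show "bounded {x. infdist x A \<le> max r 1}"
    using assms by (intro compact_imp_bounded compact_infdist_le) auto
qed (auto simp: parallel_set_def)

lemma parallel_set_lmeasurable:
  "compact A \<Longrightarrow> A \<noteq> {} \<Longrightarrow> parallel_set A r \<in> lmeasurable"
  by (simp add: bounded_parallel_set lmeasurable_open open_parallel_set)

lemma parallel_set_mono: "r \<le> t \<Longrightarrow> parallel_set A r \<subseteq> parallel_set A t"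
  by (auto simp: parallel_set_def)

lemma parallel_ring_measure:
  assumes "compact A" "A \<noteq> {}" "r \<le> t"
  shows "measure lebesgue (parallel_set A t - parallel_set A r) = parallel_volume A t - parallel_volume A r"
  unfolding parallel_volume_def using assms
  by (intro measurable_measure_Diff parallel_set_lmeasurable parallel_set_mono)
     (auto intro: fmeasurableD parallel_set_lmeasurable)

text \<open>The set \<open>M\<close> is the shell \<open>s \<le> d(x, A) < t\<close> without the image of \<open>R \<le> d(x, A) < t R / s\<close> under
  shrinking towards the nearest points by the factor \<open>s / R\<close>. Points outside that have several
  nearest points have several images. This does no harm, since the inverse map is single valued and
  expands distances by at most \<open>R / s\<close>, so the image is large enough. All its points lie on rays that
  survive up to \<open>R\<close>.\<close>

lemma ending_rays_volume:
  fixes A :: "'a::euclidean_space set"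
  assumes A: "compact A" "A \<noteq> {}" and s: "0 < s" "s \<le> t" "s < R"
  obtains M where "M \<in> lmeasurable" "bounded M"
    "\<And>u. s < u \<Longrightarrow> u < t \<Longrightarrow> ray_point u ` (normals_reaching A t - normals_reaching A R) \<subseteq> {x \<in> M. infdist x A = u}"
    "measure lebesgue M \<le> parallel_volume A t - parallel_volume A s
       - (s / R) ^ DIM('a) * (parallel_volume A (t * R / s) - parallel_volume A R)"
proof -
  define l where "l = s / R"
  have l: "0 < l" "l < 1" "l * R = s" "t * R / s = t / l" using s by (auto simp: l_def)
  define P where "P = {(x, a). a \<in> A \<and> R \<le> infdist x A \<and> infdist x A \<le> t / l \<and> dist x a = infdist x A}"
  define g :: "'a \<times> 'a \<Rightarrow> 'a" where "g = (\<lambda>(x, a). a + l *\<^sub>R (x - a))"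
  have R: "R > 0" using s by simp
  have g_ray: "\<exists>p \<in> normals_reaching A R. g (x, a) = ray_point (l * infdist x A) p \<and> infdist (g (x, a)) A = l * infdist x A"
    if "(x, a) \<in> P" for x a
  proof (intro bexI conjI)
    let ?d = "infdist x A"
    let ?p = "(a, (x - a) /\<^sub>R ?d)"
    have d: "?d \<ge> R" "a \<in> A" "dist x a = ?d" using that by (auto simp: P_def)
    then have p: "?p \<in> normals_reaching A ?d"
      using R by (intro normals_reaching_nearest) auto
    then show "?p \<in> normals_reaching A R" using normals_reaching_antimono[of R ?d A] d R by auto
    show eq: "g (x, a) = ray_point (l * ?d) ?p" using d R by (simp add: g_def ray_point_def)
    have "l * ?d \<le> 1 * ?d" using l d R by (intro mult_right_mono) auto
    then show "infdist (g (x, a)) A = l * ?d"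
      unfolding eq using l d R by (intro infdist_ray_point[OF p]) auto
  qed
  have expand: "dist (fst z) (fst z') \<le> 1 / l * dist (g z) (g z')" if "z \<in> P" "z' \<in> P" for z z'
  proof -
    obtain x a x' a' where z: "z = (x, a)" "z' = (x', a')" by (meson prod.exhaust)
    have "0 \<le> (x - x') \<bullet> (a - a')"
      using that nearest_point_monotone[of a A x a' x'] by (auto simp: z P_def inner_commute)
    then have "norm (l *\<^sub>R (x - x') + 0 *\<^sub>R (a - a')) \<le> norm (l *\<^sub>R (x - x') + (1 - l) *\<^sub>R (a - a'))"
      using l by (intro norm_add_scaleR_mono) auto
    also have "l *\<^sub>R (x - x') + (1 - l) *\<^sub>R (a - a') = g z - g z'"
      by (simp add: z g_def algebra_simps)
    finally have "l * dist x x' \<le> dist (g z) (g z')"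
      using l by (simp add: dist_norm flip: scaleR_diff_right)
    then show ?thesis using l by (simp add: z field_simps)
  qed
  \<comment> \<open>Compactness makes the image of \<open>P\<close> measurable, so \<open>P\<close> is taken closed and the
    half-open shell is cut out afterwards.\<close>
  have "compact P"
  proof -
    have "P = ({x. infdist x A \<le> max (t / l) 1} \<times> A) \<inter>
        {z. R \<le> infdist (fst z) A \<and> infdist (fst z) A \<le> t / l \<and> dist (fst z) (snd z) = infdist (fst z) A}"
      by (auto simp: P_def)
    moreover have "compact ({x. infdist x A \<le> max (t / l) 1} \<times> A)"
      using A by (intro compact_Times compact_infdist_le) auto
    moreover have "closed {z :: 'a \<times> 'a. R \<le> infdist (fst z) A \<and> infdist (fst z) A \<le> t / l \<and> dist (fst z) (snd z) = infdist (fst z) A}"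
      by (intro closed_Collect_conj closed_Collect_le closed_Collect_eq continuous_intros)
    ultimately show ?thesis by (simp add: compact_Int_closed)
  qed
  then have "compact (g ` P)"
    unfolding g_def split_def by (intro compact_continuous_image continuous_intros)
  define I where "I = g ` P \<inter> parallel_set A t"
  have I: "I \<in> lmeasurable"
    unfolding I_def using \<open>compact (g ` P)\<close> A
    by (intro fmeasurable.Int lmeasurable_compact parallel_set_lmeasurable)
  have I_ring: "I \<subseteq> parallel_set A t - parallel_set A s"
  proof
    fix y assume "y \<in> I"
    then obtain x a where xa: "(x, a) \<in> P" "y = g (x, a)" "y \<in> parallel_set A t" by (auto simp: I_def)
    have "s \<le> l * infdist x A"
      using xa(1) l by (simp add: P_def flip: l(3))
    then have "s \<le> infdist y A" using g_ray[OF xa(1)] xa(2) by auto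
    then show "y \<in> parallel_set A t - parallel_set A s" using xa(3) by (auto simp: parallel_set_def)
  qed
  define X where "X = parallel_set A (t / l) - parallel_set A R"
  define P' where "P' = {z \<in> P. infdist (fst z) A < t / l}"
  have gP': "g ` P' \<subseteq> I"
  proof (rule image_subsetI)
    fix z assume "z \<in> P'"
    then have "z \<in> P" "infdist (fst z) A < t / l" by (auto simp: P'_def)
    then have "infdist (g z) A < t" using g_ray[of "fst z" "snd z"] l by (auto simp: field_simps)
    then show "g z \<in> I" using \<open>z \<in> P\<close> by (auto simp: I_def parallel_set_def)
  qed
  have X_sub: "X \<subseteq> fst ` P'"
  proof
    fix x assume x: "x \<in> X"
    obtain a where "a \<in> A" "dist x a = infdist x A" using infdist_attained[OF A] .
    then have "(x, a) \<in> P'" using x by (auto simp: P'_def P_def X_def parallel_set_def)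
    then show "x \<in> fst ` P'" by force
  qed
  define f where "f y = fst (inv_into P g y)" for y
  have fg: "f (g z) = fst z" if "z \<in> P" for z
  proof -
    have *: "inv_into P g (g z) \<in> P" "g (inv_into P g (g z)) = g z"
      using that by (auto intro: inv_into_into f_inv_into_f)
    have "dist (f (g z)) (fst z) \<le> 0" using expand[OF *(1) that] *(2) by (simp add: f_def)
    then show ?thesis by simp
  qed
  have "emeasure lebesgue X \<le> ennreal ((1 / l) ^ DIM('a)) * emeasure lebesgue I"
  proof (rule emeasure_Lipschitz_image_le)
    show "I \<in> sets lebesgue" using I by auto
    show "X \<in> sets lebesgue" using parallel_set_lmeasurable[OF A] by (auto simp: X_def)
    show "X \<subseteq> f ` I"
    proof
      fix x assume "x \<in> X"
      then obtain z where "z \<in> P'" "x = fst z" using X_sub by auto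
      then show "x \<in> f ` I" using gP' fg[of z] by (force simp: P'_def)
    qed
    show "dist (f x) (f y) \<le> 1 / l * dist x y" if xy: "x \<in> I" "y \<in> I" for x y
    proof -
      obtain z z' where "z \<in> P" "z' \<in> P" "x = g z" "y = g z'" using xy by (auto simp: I_def)
      then show ?thesis using expand[of z z'] by (simp add: fg)
    qed
  qed (use l in simp)
  moreover have "X \<in> lmeasurable" unfolding X_def by (intro fmeasurable.Diff parallel_set_lmeasurable A)
  ultimately have "measure lebesgue X \<le> (1 / l) ^ DIM('a) * measure lebesgue I"
    using I l by (simp add: emeasure_eq_measure2 ennreal_mult'[symmetric])
  then have X_le: "l ^ DIM('a) * measure lebesgue X \<le> measure lebesgue I"
    using l by (simp add: field_simps power_divide)
  have X_eq: "measure lebesgue X = parallel_volume A (t / l) - parallel_volume A R"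
    unfolding X_def
  proof (rule parallel_ring_measure[OF A])
    show "R \<le> t / l" using l s by (simp add: field_simps)
  qed
  define M where "M = (parallel_set A t - parallel_set A s) - I"
  have ring: "parallel_set A t - parallel_set A s \<in> lmeasurable"
    by (intro fmeasurable.Diff parallel_set_lmeasurable A)
  show thesis
  proof
    show "M \<in> lmeasurable" unfolding M_def using ring I by (rule fmeasurable.Diff)
    show "bounded M"
      using bounded_parallel_set[OF A, of t] by (rule bounded_subset) (auto simp: M_def)
    show "ray_point u ` (normals_reaching A t - normals_reaching A R) \<subseteq> {x \<in> M. infdist x A = u}"
      if u: "s < u" "u < t" for u
    proof (rule image_subsetI)
      fix p assume "p \<in> normals_reaching A t - normals_reaching A R"
      then have p: "p \<in> normals_reaching A t" "p \<notin> normals_reaching A R" by auto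
      have du: "infdist (ray_point u p) A = u" using u s by (intro infdist_ray_point[OF p(1)]) auto
      have "ray_point u p \<notin> I"
      proof
        assume "ray_point u p \<in> I"
        then obtain x a where xa: "(x, a) \<in> P" "ray_point u p = g (x, a)" by (auto simp: I_def)
        obtain q where q: "q \<in> normals_reaching A R" "g (x, a) = ray_point (l * infdist x A) q"
          "infdist (g (x, a)) A = l * infdist x A" using g_ray[OF xa(1)] by blast
        have eq: "ray_point u p = ray_point u q" using q(2,3) xa(2) du by simp
        have "q \<in> normals_reaching A u"
        proof (cases "u \<le> R")
          case True
          then show ?thesis using q(1) normals_reaching_antimono[of u R A] u s by auto
        next
          case False
          have "fst q \<in> A" "norm (snd q) = 1" using q(1) by (auto simp: normals_reaching_def)
          then show ?thesis using du eq by (auto simp: normals_reaching_def ray_point_def split_beta)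
        qed
        then have "p = q" using ray_point_eqD[OF p(1) _ u(2)] eq u s by auto
        then show False using q(1) p(2) by simp
      qed
      then show "ray_point u p \<in> {x \<in> M. infdist x A = u}"
        using du u by (auto simp: M_def parallel_set_def)
    qed
    have "measure lebesgue M = measure lebesgue (parallel_set A t - parallel_set A s) - measure lebesgue I"
      unfolding M_def using I_ring by (intro measurable_measure_Diff ring fmeasurableD[OF I])
    then show "measure lebesgue M \<le> parallel_volume A t - parallel_volume A s
       - (s / R) ^ DIM('a) * (parallel_volume A (t * R / s) - parallel_volume A R)"
      using X_le X_eq parallel_ring_measure[OF A s(2)] by (simp add: l(4) flip: l_def)
  qed
qed

section \<open>Rays ending near a differentiability radius\<close>

text \<open>The bound for the volume in \<open>ending_rays_volume\<close>, with \<open>s = r\<^sub>0 - 2h\<close>, \<open>t = r\<^sub>0 - h\<close> and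
  \<open>R = r\<^sub>0 + h\<close>, is \<open>o(h)\<close>: both increments of \<open>V\<close> are \<open>V' h + o(h)\<close>, because
  \<open>t R / s = r\<^sub>0 + 2h + o(h)\<close>, and the weight of the second one tends to \<open>1\<close>.\<close>

lemma weighted_second_difference_tendsto_0:
  fixes V :: "real \<Rightarrow> real"
  assumes "V differentiable (at r0)" "r0 > 0"
  shows "((\<lambda>h. (V (r0 - h) - V (r0 - 2 * h)
      - ((r0 - 2 * h) / (r0 + h)) ^ d * (V ((r0 - h) * (r0 + h) / (r0 - 2 * h)) - V (r0 + h))) / h)
    \<longlongrightarrow> 0) (at_right 0)"
proof -
  \<comment> \<open>Caratheodory's form of the derivative turns the limit into continuity at \<open>h = 0\<close>.\<close>
  obtain D where "(V has_real_derivative D) (at r0)"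
    using assms(1) by (auto simp: real_differentiable_def)
  then obtain g where g: "\<And>z. V z - V r0 = g z * (z - r0)" "isCont g r0"
    unfolding CARAT_DERIV by blast
  define z where "z h = (r0 - h) * (r0 + h) / (r0 - 2 * h)" for h
  define F where "F h = - g (r0 - h) + 2 * g (r0 - 2 * h)
    - ((r0 - 2 * h) / (r0 + h)) ^ d * ((2 * r0 - h) / (r0 - 2 * h) * g (z h) - g (r0 + h))" for h
  have z0: "z 0 = r0" using assms(2) by (simp add: z_def)
  have gk: "isCont (\<lambda>h. g (k h)) 0" if "isCont k 0" "k 0 = r0" for k
    using isCont_o2[of 0 k g] that g(2) by simp
  have "isCont z 0" using assms(2) unfolding z_def by (intro continuous_intros) auto
  then have "isCont F 0"
    using assms(2) unfolding F_def by (intro continuous_intros gk) (auto simp: z0)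
  moreover have "F 0 = 0" using assms(2) z0 by (simp add: F_def)
  ultimately have "(F \<longlongrightarrow> 0) (at_right 0)"
    by (metis isCont_def filterlim_at_split)
  moreover have "\<forall>\<^sub>F h in at_right 0. F h =
      (V (r0 - h) - V (r0 - 2 * h)
      - ((r0 - 2 * h) / (r0 + h)) ^ d * (V ((r0 - h) * (r0 + h) / (r0 - 2 * h)) - V (r0 + h))) / h"
  proof -
    have "\<forall>\<^sub>F h in at_right 0. h \<in> {0<..<r0 / 2}"
      using assms(2) by (intro eventually_at_right_real) simp
    then show ?thesis
    proof eventually_elim
      fix h assume h: "h \<in> {0<..<r0 / 2}"
      have V: "V x = V r0 + g x * (x - r0)" for x using g(1)[of x] by simp
      have zh: "z h - r0 = h * ((2 * r0 - h) / (r0 - 2 * h))"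
        using h by (simp add: z_def field_simps)
      show "F h = (V (r0 - h) - V (r0 - 2 * h)
      - ((r0 - 2 * h) / (r0 + h)) ^ d * (V ((r0 - h) * (r0 + h) / (r0 - 2 * h)) - V (r0 + h))) / h"
        unfolding z_def[symmetric] V[of "r0 - h"] V[of "r0 - 2 * h"] V[of "z h"] V[of "r0 + h"] zh F_def
        using h by (simp add: field_simps)
    qed
  qed
  ultimately show ?thesis by (rule Lim_transform_eventually)
qed

lemma hausdorff_outward_le:
  assumes "G \<subseteq> normals_reaching A r" "0 < u" "u \<le> r"
  shows "hausdorff m (ray_point r ` G) \<le> ennreal ((r / u) ^ m) * hausdorff m (ray_point u ` G)"
  using assms by (intro hausdorff_Lipschitz_le ray_point_outward_Lipschitz) auto

lemma hausdorff_inward_le: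
  assumes "G \<subseteq> normals_reaching A R" "0 \<le> r" "r \<le> s" "s < R"
  shows "hausdorff m (ray_point r ` G) \<le> ennreal (((R - r) / (R - s)) ^ m) * hausdorff m (ray_point s ` G)"
  using assms by (intro hausdorff_Lipschitz_le ray_point_inward_Lipschitz) auto

text \<open>A lower bound for the areas at all levels \<open>u\<close> between \<open>s\<close> and \<open>t\<close> follows from the area at radius
  \<open>r\<close> by the outward Lipschitz bound, whose constant is at most \<open>2\<close>. Eilenberg's inequality then
  bounds this area by the volume \<open>o(h)\<close> divided by \<open>t - s = h\<close>. Only
  radii near \<open>r\<^sub>0\<close> can be controlled: for a sphere of radius \<open>r\<^sub>0\<close> in dimension at least two all inner
  normals end in the centre, so their area is positive at each fixed smaller radius and merely tends to \<open>0\<close> at \<open>r\<^sub>0\<close>.\<close>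

lemma ending_rays_hausdorff_small:
  fixes A :: "'a::euclidean_space set"
  assumes A: "compact A" "A \<noteq> {}" and r0: "r0 > 0" "(\<lambda>r. parallel_volume A r) differentiable (at r0)"
    and \<epsilon>: "\<epsilon> > 0"
  shows "\<forall>\<^sub>F h in at_right 0. \<forall>r \<in> {r0 - h..r0}.
    hausdorff (DIM('a) - 1) (ray_point r ` (normals_reaching A r - normals_reaching A (r0 + h))) \<le> ennreal \<epsilon>"
proof -
  define m where "m = DIM('a) - 1"
  define C where "C = 4 * unit_ball_vol (DIM('a) - 1) / 2 ^ DIM('a) * sqrt (DIM('a)) ^ DIM('a)"
  have C: "C \<ge> 0" by (simp add: C_def)
  define \<delta> where "\<delta> = \<epsilon> / (2 ^ m * (C + 1))"
  have \<delta>: "\<delta> > 0" "2 ^ m * (C * \<delta>) \<le> \<epsilon>"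
  proof -
    show "\<delta> > 0" using \<epsilon> C by (simp add: \<delta>_def)
    have "2 ^ m * (C * \<delta>) \<le> 2 ^ m * ((C + 1) * \<delta>)"
      using \<open>\<delta> > 0\<close> by (intro mult_left_mono mult_right_mono) auto
    also have "\<dots> = \<epsilon>" using C by (simp add: \<delta>_def)
    finally show "2 ^ m * (C * \<delta>) \<le> \<epsilon>" .
  qed
  have "\<forall>\<^sub>F h in at_right 0. h \<in> {0<..<r0 / 4}"
    using r0(1) by (intro eventually_at_right_real) simp
  moreover have "\<forall>\<^sub>F h in at_right 0. (parallel_volume A (r0 - h) - parallel_volume A (r0 - 2 * h)
      - ((r0 - 2 * h) / (r0 + h)) ^ DIM('a) * (parallel_volume A ((r0 - h) * (r0 + h) / (r0 - 2 * h))
        - parallel_volume A (r0 + h))) / h < \<delta>"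
    using weighted_second_difference_tendsto_0[OF r0(2,1)] \<delta>(1) by (rule order_tendstoD(2))
  ultimately show ?thesis
  proof eventually_elim
    fix h assume h: "h \<in> {0<..<r0 / 4}" and
      small: "(parallel_volume A (r0 - h) - parallel_volume A (r0 - 2 * h)
      - ((r0 - 2 * h) / (r0 + h)) ^ DIM('a) * (parallel_volume A ((r0 - h) * (r0 + h) / (r0 - 2 * h))
        - parallel_volume A (r0 + h))) / h < \<delta>"
    define s t R where "s = r0 - 2 * h" and "t = r0 - h" and "R = r0 + h"
    have str: "0 < s" "s < t" "t \<le> r0" "r0 < R" "r0 \<le> 2 * s" "t - s = h"
      using h by (auto simp: s_def t_def R_def)
    obtain M where M: "M \<in> lmeasurable" "bounded M"
      "\<And>u. s < u \<Longrightarrow> u < t \<Longrightarrow> ray_point u ` (normals_reaching A t - normals_reaching A R) \<subseteq> {x \<in> M. infdist x A = u}"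
      "measure lebesgue M \<le> parallel_volume A t - parallel_volume A s
         - (s / R) ^ DIM('a) * (parallel_volume A (t * R / s) - parallel_volume A R)"
      by (rule ending_rays_volume[OF A, of s t R]) (use str in auto)
    have "measure lebesgue M \<le> \<delta> * h"
      using M(4) small h by (simp add: s_def t_def R_def pos_divide_less_eq)
    then have eM: "emeasure lebesgue M \<le> ennreal (\<delta> * h)"
      using M(1) by (simp add: emeasure_eq_measure2 ennreal_leI)
    show "\<forall>r \<in> {r0 - h..r0}. hausdorff (DIM('a) - 1) (ray_point r ` (normals_reaching A r - normals_reaching A (r0 + h))) \<le> ennreal \<epsilon>"
    proof
      fix r assume r: "r \<in> {r0 - h..r0}"
      let ?G = "normals_reaching A r - normals_reaching A R"
      let ?H = "hausdorff m (ray_point r ` ?G)"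
      have tr: "t \<le> r" "r \<le> 2 * s" using r str by (auto simp: t_def)
      have G: "?G \<subseteq> normals_reaching A t - normals_reaching A R"
        using normals_reaching_antimono[of t r A] tr str by auto
      have "?H / ennreal (2 ^ m) \<le> hausdorff m {x \<in> M. infdist x A = u}" if u: "s < u" "u < t" for u
      proof (rule divide_le_posI_ennreal)
        have "?H \<le> ennreal ((r / u) ^ m) * hausdorff m (ray_point u ` ?G)"
          using u tr str by (intro hausdorff_outward_le) auto
        also have "\<dots> \<le> ennreal (2 ^ m) * hausdorff m {x \<in> M. infdist x A = u}"
        proof (intro mult_mono ennreal_leI power_mono hausdorff_mono)
          show "r / u \<le> 2" using u tr str by (simp add: field_simps)
          show "ray_point u ` ?G \<subseteq> {x \<in> M. infdist x A = u}"
            using M(3)[OF u] G by blast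
        qed (use u tr str in auto)
        finally show "?H \<le> ennreal (2 ^ m) * hausdorff m {x \<in> M. infdist x A = u}" .
      qed simp
      then have "?H / ennreal (2 ^ m) * ennreal (t - s) \<le> ennreal C * emeasure lebesgue M"
        unfolding C_def m_def
        by (intro Eilenberg_level_set_bound[OF M(1,2), where f = "\<lambda>x. infdist x A"])
           (use infdist_triangle_abs in auto)
      also have "\<dots> \<le> ennreal C * ennreal (\<delta> * h)" by (intro mult_left_mono eM) auto
      also have "\<dots> = ennreal (C * \<delta>) * ennreal (t - s)"
        using C \<delta> h str by (simp add: ennreal_mult'[symmetric] mult_ac)
      finally have "?H / ennreal (2 ^ m) \<le> ennreal (C * \<delta>)"
        using h str(6) by (simp add: mult.commute[of _ "ennreal h"] ennreal_mult_le_mult_iff)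
      then have "ennreal (2 ^ m) * (?H / ennreal (2 ^ m)) \<le> ennreal (2 ^ m) * ennreal (C * \<delta>)"
        by (rule mult_left_mono) simp
      also have "ennreal (2 ^ m) * (?H / ennreal (2 ^ m)) = ?H"
        using mult_divide_eq_ennreal[of "ennreal (2 ^ m)" ?H]
        by (simp add: ennreal_times_divide mult.commute)
      also have "ennreal (2 ^ m) * ennreal (C * \<delta>) \<le> ennreal \<epsilon>"
        using \<delta>(2) by (simp add: ennreal_mult'[symmetric] ennreal_leI)
      finally show "hausdorff (DIM('a) - 1) (ray_point r ` (normals_reaching A r - normals_reaching A (r0 + h))) \<le> ennreal \<epsilon>"
        by (simp add: m_def R_def)
    qed
  qed
qed

section \<open>Continuity of the surface area measure\<close>

text \<open>Exactly the pairs that \<^const>\<open>normal_proj\<close> takes on the surface at distance \<open>r\<close>; they lie between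
  \<^term>\<open>normals_reaching A r\<close> and its subsets for larger radii.\<close>

definition unp_normals :: "'a::euclidean_space set \<Rightarrow> real \<Rightarrow> ('a \<times> 'a) set" where
  "unp_normals A r = {p \<in> normals_reaching A r. ray_point r p \<in> Unp A}"

lemma normals_reaching_subset_unp_normals:
  assumes "0 < r" "r < R"
  shows "normals_reaching A R \<subseteq> unp_normals A r"
proof
  fix p assume p: "p \<in> normals_reaching A R"
  have d: "infdist (ray_point r p) A = r" "dist (ray_point r p) (fst p) = r"
    using infdist_ray_point[OF p, of r] dist_ray_point[OF p, of r] assms by auto
  have "ray_point r p \<in> Unp A"
    unfolding Unp_def mem_Collect_eq
  proof (rule ex1I[of _ "fst p"])
    show near: "fst p \<in> A \<and> (\<forall>z\<in>A. dist (ray_point r p) (fst p) \<le> dist (ray_point r p) z)"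
      using p infdist_le[of _ A "ray_point r p"] by (auto simp: normals_reaching_def d)
    fix b assume b: "b \<in> A \<and> (\<forall>z\<in>A. dist (ray_point r p) b \<le> dist (ray_point r p) z)"
    then have "dist (ray_point r p) b = r"
      using near infdist_le[of b A "ray_point r p"] d by fastforce
    then show "b = fst p" using ray_point_unique_nearest[OF p _ assms(2)] b assms(1) by auto
  qed
  then show "p \<in> unp_normals A r"
    using p assms normals_reaching_antimono[of r R A] by (auto simp: unp_normals_def)
qed

lemma unp_normals_antimono:
  assumes "0 < r" "r \<le> R"
  shows "unp_normals A R \<subseteq> unp_normals A r"
  using assms normals_reaching_subset_unp_normals[of r R A]
  by (cases "r = R") (auto simp: unp_normals_def)

lemma frontier_parallel_set:
  fixes A :: "'a::euclidean_space set"
  assumes A: "compact A" "A \<noteq> {}" and r: "r > 0"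
  shows "frontier (parallel_set A r) = {x. infdist x A = r}"
proof (intro equalityI subsetI)
  have "closure (parallel_set A r) \<subseteq> {x. infdist x A \<le> r}"
    by (intro closure_minimal closed_Collect_le continuous_intros) (auto simp: parallel_set_def)
  then show "x \<in> {x. infdist x A = r}" if "x \<in> frontier (parallel_set A r)" for x
    using that interior_open[OF open_parallel_set, of A r]
    by (fastforce simp: frontier_def parallel_set_def)
next
  fix x assume "x \<in> {x. infdist x A = r}"
  then have x: "infdist x A = r" by simp
  obtain a where a: "a \<in> A" "dist x a = r" using infdist_attained[OF A, of x] x by metis
  have "x \<in> closure (parallel_set A r)"
    unfolding closure_approachable
  proof (intro allI impI)
    fix e :: real assume e: "e > 0"
    define \<tau> where "\<tau> = min 1 (e / (2 * r))"
    have \<tau>: "0 < \<tau>" "\<tau> \<le> 1" "\<tau> * r < e"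
    proof -
      have "\<tau> * r \<le> e / (2 * r) * r" using r by (intro mult_right_mono) (auto simp: \<tau>_def)
      then show "\<tau> * r < e" using r e by simp
    qed (use e r in \<open>auto simp: \<tau>_def\<close>)
    let ?y = "x + \<tau> *\<^sub>R (a - x)"
    have "?y - a = (1 - \<tau>) *\<^sub>R (x - a)" by (simp add: algebra_simps)
    then have "dist ?y a = (1 - \<tau>) * r" using \<tau> a by (simp add: dist_norm)
    also have "\<dots> < r" using \<tau> r by simp
    finally have "?y \<in> parallel_set A r"
      using infdist_le[OF a(1), of ?y] by (simp add: parallel_set_def)
    moreover have "dist ?y x < e" using \<tau> a by (simp add: dist_norm norm_minus_commute)
    ultimately show "\<exists>y\<in>parallel_set A r. dist y x < e" by blast
  qed
  then show "x \<in> frontier (parallel_set A r)"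
    using x by (simp add: frontier_def interior_open open_parallel_set) (simp add: parallel_set_def)
qed

lemma surface_measure_normal_proj_vimage:
  fixes A :: "'a::euclidean_space set"
  assumes A: "compact A" "A \<noteq> {}" and r: "r > 0"
  shows "surface_measure A r (normal_proj_vimage A \<beta>)
    = hausdorff (DIM('a) - 1) (ray_point r ` (\<beta> \<inter> unp_normals A r))"
proof -
  have cp: "closest_point A x \<in> A" "dist x (closest_point A x) = infdist x A" for x
  proof -
    have c: "closest_point A x \<in> A" "\<And>y. y \<in> A \<Longrightarrow> dist x (closest_point A x) \<le> dist x y"
      using closest_point_exists[OF compact_imp_closed[OF A(1)] A(2), of x] by auto
    show "closest_point A x \<in> A" by (rule c)
    obtain a where "a \<in> A" "dist x a = infdist x A" using infdist_attained[OF A] .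
    then show "dist x (closest_point A x) = infdist x A"
      using c(2)[of a] infdist_le[OF c(1), of x] by simp
  qed
  have "frontier (parallel_set A r) \<inter> normal_proj_vimage A \<beta> = ray_point r ` (\<beta> \<inter> unp_normals A r)"
    unfolding frontier_parallel_set[OF A r]
  proof (intro equalityI subsetI)
    fix x assume "x \<in> {x. infdist x A = r} \<inter> normal_proj_vimage A \<beta>"
    then have x: "infdist x A = r" "x \<in> Unp A" "normal_proj A x \<in> \<beta>"
      by (auto simp: normal_proj_vimage_def)
    have np: "normal_proj A x = (closest_point A x, (x - closest_point A x) /\<^sub>R r)"
      using cp(2)[of x] x(1) by (simp add: normal_proj_def dist_norm)
    then have rp: "ray_point r (normal_proj A x) = x" using r by (simp add: ray_point_def)
    have "normal_proj A x \<in> normals_reaching A r"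
      unfolding np using normals_reaching_nearest[OF cp, of x] x(1) r by simp
    then have "normal_proj A x \<in> \<beta> \<inter> unp_normals A r" using x rp by (simp add: unp_normals_def)
    then show "x \<in> ray_point r ` (\<beta> \<inter> unp_normals A r)" using rp by (metis imageI)
  next
    fix x assume "x \<in> ray_point r ` (\<beta> \<inter> unp_normals A r)"
    then obtain p where p: "p \<in> \<beta>" "p \<in> normals_reaching A r" "x \<in> Unp A" "x = ray_point r p"
      by (auto simp: unp_normals_def)
    have d: "infdist x A = r" "dist x (fst p) = r" "fst p \<in> A"
      using infdist_ray_point[OF p(2), of r] dist_ray_point[OF p(2), of r] r p
      by (auto simp: normals_reaching_def)
    have "closest_point A x = fst p"
    proof -
      have "\<exists>!y. y \<in> A \<and> (\<forall>z\<in>A. dist x y \<le> dist x z)" using p(3) by (simp add: Unp_def)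
      moreover have "fst p \<in> A \<and> (\<forall>z\<in>A. dist x (fst p) \<le> dist x z)"
        using d infdist_le[of _ A x] by auto
      moreover have "closest_point A x \<in> A \<and> (\<forall>z\<in>A. dist x (closest_point A x) \<le> dist x z)"
        using cp[of x] infdist_le[of _ A x] by auto
      ultimately show ?thesis by blast
    qed
    moreover have "x - fst p = r *\<^sub>R snd p" by (simp add: p(4) ray_point_def)
    moreover have "norm (snd p) = 1" using p(2) by (auto simp: normals_reaching_def)
    ultimately have "normal_proj A x = p" using r by (simp add: normal_proj_def prod_eq_iff)
    moreover have "x \<notin> A" using d(1) r by auto
    ultimately show "x \<in> {x. infdist x A = r} \<inter> normal_proj_vimage A \<beta>"
      using d(1) p by (simp add: normal_proj_vimage_def)
  qed
  then show ?thesis by (simp add: surface_measure_def)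
qed

text \<open>Used to absorb a factor close to \<open>1\<close> and a small additive error into a strict inequality; it
  includes an infinite \<open>y\<close>, so that limits need no separate treatment of infinite measures.\<close>

lemma ennreal_less_affine_gap:
  fixes x y :: ennreal
  assumes "x < y"
  obtains q e :: real where "q > 1" "e > 0" "ennreal q * x + ennreal e < y"
proof -
  obtain z where z: "x < z" "z < y" using dense[OF assms] by blast
  obtain a where a: "x = ennreal a" "a \<ge> 0" using z(1) by (cases x) auto
  obtain b where b: "z = ennreal b" "b \<ge> 0" using z(2) by (cases z) auto
  have ab: "a < b" using z(1) a b by (simp add: ennreal_less_iff)
  define h where "h = (b - a) / (a + 1)"
  have "h * (a + 1) = b - a" using a by (simp add: h_def)
  then have h: "h > 0" "(1 + h) * a + h = b"
    using ab a by (simp add: h_def, simp add: algebra_simps)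
  then have "ennreal (1 + h) * x + ennreal h = z"
    using a b by (simp add: ennreal_mult'[symmetric] flip: ennreal_plus)
  then show thesis using that[of "1 + h" h] h z(2) by simp
qed

lemma tendsto_ennreal_quasi_equal:
  fixes f :: "'b \<Rightarrow> ennreal"
  assumes "\<And>q e :: real. q > 1 \<Longrightarrow> e > 0 \<Longrightarrow>
    \<forall>\<^sub>F x in F. f x \<le> ennreal q * l + ennreal e \<and> l \<le> ennreal q * f x + ennreal e"
  shows "(f \<longlongrightarrow> l) F"
proof (rule order_tendstoI)
  fix a assume "a < l"
  then obtain q e :: real where q: "q > 1" "e > 0" "ennreal q * a + ennreal e < l"
    by (rule ennreal_less_affine_gap)
  show "\<forall>\<^sub>F x in F. a < f x"
    using assms[OF q(1,2)]
  proof eventually_elim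
    fix x assume l: "f x \<le> ennreal q * l + ennreal e \<and> l \<le> ennreal q * f x + ennreal e"
    show "a < f x"
    proof (rule ccontr)
      assume "\<not> a < f x"
      then have "ennreal q * f x + ennreal e \<le> ennreal q * a + ennreal e"
        by (intro add_right_mono mult_left_mono) auto
      then show False using l q(3) by (meson leD order_trans)
    qed
  qed
next
  fix a assume "l < a"
  then obtain q e :: real where q: "q > 1" "e > 0" "ennreal q * l + ennreal e < a"
    by (rule ennreal_less_affine_gap)
  show "\<forall>\<^sub>F x in F. f x < a"
    using assms[OF q(1,2)] by eventually_elim (use q(3) in \<open>auto intro: le_less_trans\<close>)
qed

theorem lemma4p3:
  fixes A :: "'a::euclidean_space set" and r0 :: real and \<beta> :: "('a \<times> 'a) set"
  assumes "A \<noteq> {}" and "compact A"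
    and "r0 > 0" and "(\<lambda>r. parallel_volume A r) differentiable (at r0)"
    and "\<beta> \<in> sets borel" and "\<beta> \<subseteq> normal_bundle A"
  shows "((\<lambda>r. surface_measure A r (normal_proj_vimage A \<beta>))
            \<longlongrightarrow> surface_measure A r0 (normal_proj_vimage A \<beta>)) (at r0)"
proof (rule tendsto_ennreal_quasi_equal)
  note A = assms(2,1)
  define m where "m = DIM('a) - 1"
  define S where "S r = surface_measure A r (normal_proj_vimage A \<beta>)" for r
  have S: "S r = hausdorff m (ray_point r ` (\<beta> \<inter> unp_normals A r))" if "r > 0" for r
    using surface_measure_normal_proj_vimage[OF A that] by (simp add: S_def m_def)
  have outward: "S b \<le> ennreal ((b / a) ^ m) * S a" if ab: "0 < a" "a \<le> b" for a b
  proof -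
    have "\<beta> \<inter> unp_normals A b \<subseteq> normals_reaching A b" by (auto simp: unp_normals_def)
    then have "S b \<le> ennreal ((b / a) ^ m) * hausdorff m (ray_point a ` (\<beta> \<inter> unp_normals A b))"
      using ab by (simp add: S hausdorff_outward_le)
    also have "\<dots> \<le> ennreal ((b / a) ^ m) * S a"
      using ab unp_normals_antimono[of a b A] by (auto simp: S intro!: mult_left_mono hausdorff_mono)
    finally show ?thesis .
  qed
  have inward: "S a \<le> ennreal (((R - a) / (R - b)) ^ m) * S b
      + hausdorff m (ray_point a ` (normals_reaching A a - normals_reaching A R))"
    if ab: "0 < a" "a \<le> b" "b < R" for a b R
  proof -
    let ?E = "ray_point a ` (normals_reaching A a - normals_reaching A R)"
    have "ray_point a ` (\<beta> \<inter> unp_normals A a) \<subseteq> ray_point a ` (\<beta> \<inter> normals_reaching A R) \<union> ?E"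
      by (auto simp: unp_normals_def)
    then have "S a \<le> hausdorff m (ray_point a ` (\<beta> \<inter> normals_reaching A R)) + hausdorff m ?E"
      unfolding S[OF ab(1)] by (rule order_trans[OF hausdorff_mono hausdorff_Un])
    also have "hausdorff m (ray_point a ` (\<beta> \<inter> normals_reaching A R))
        \<le> ennreal (((R - a) / (R - b)) ^ m) * hausdorff m (ray_point b ` (\<beta> \<inter> normals_reaching A R))"
      using ab by (intro hausdorff_inward_le) auto
    also have "hausdorff m (ray_point b ` (\<beta> \<inter> normals_reaching A R)) \<le> S b"
    proof -
      have "\<beta> \<inter> normals_reaching A R \<subseteq> \<beta> \<inter> unp_normals A b"
        using ab normals_reaching_subset_unp_normals[of b R A] by auto
      moreover have "b > 0" using ab by simp
      ultimately show ?thesis by (simp add: S hausdorff_mono image_mono)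
    qed
    finally show ?thesis by (simp add: add_right_mono mult_left_mono)
  qed
  fix q e :: real assume q: "q > 1" and e: "e > 0"
  \<comment> \<open>The error terms at radii in \<open>[r0 - h, r0]\<close> cover both sides of the limit: the error in
    \<open>inward\<close> sits at the smaller radius, which is \<open>r\<close> on the left and \<open>r0\<close> on the right.\<close>
  let ?small = "\<lambda>h. \<forall>r \<in> {r0 - h..r0}.
      hausdorff m (ray_point r ` (normals_reaching A r - normals_reaching A (r0 + h))) \<le> ennreal e"
  have "\<forall>\<^sub>F h in at_right 0. h \<in> {0<..<r0}"
    using assms(3) by (rule eventually_at_right_real)
  moreover have "\<forall>\<^sub>F h in at_right 0. ?small h"
    unfolding m_def by (rule ending_rays_hausdorff_small[OF A assms(3,4) e])
  ultimately have "\<forall>\<^sub>F h in at_right 0. h \<in> {0<..<r0} \<and> ?small h"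
    by (rule eventually_conj)
  then have "\<exists>h. h \<in> {0<..<r0} \<and> ?small h"
    by (rule eventually_happens'[rotated]) simp
  then obtain h where h: "0 < h" "h < r0" and small: "\<And>r. r \<in> {r0 - h..r0} \<Longrightarrow>
      hausdorff m (ray_point r ` (normals_reaching A r - normals_reaching A (r0 + h))) \<le> ennreal e"
    by auto
  define R where "R = r0 + h"
  have ratios: "((\<lambda>r. (r / r0) ^ m) \<longlongrightarrow> 1) (at r0)"
    "((\<lambda>r. (r0 / r) ^ m) \<longlongrightarrow> 1) (at r0)"
    "((\<lambda>r. ((R - r0) / (R - r)) ^ m) \<longlongrightarrow> 1) (at r0)"
    "((\<lambda>r. ((R - r) / (R - r0)) ^ m) \<longlongrightarrow> 1) (at r0)"
    using assms(3) h by (auto intro!: tendsto_eq_intros simp: R_def)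
  have "\<forall>\<^sub>F r in at r0. r \<in> {r0 - h<..<R}"
    using h by (intro eventually_at_in_open') (auto simp: R_def)
  then show "\<forall>\<^sub>F r in at r0. S r \<le> ennreal q * S r0 + ennreal e \<and> S r0 \<le> ennreal q * S r + ennreal e"
    using ratios[THEN order_tendstoD(2), OF q]
  proof eventually_elim
    fix r assume r: "r \<in> {r0 - h<..<R}"
      and ratio: "(r / r0) ^ m < q" "(r0 / r) ^ m < q"
        "((R - r0) / (R - r)) ^ m < q" "((R - r) / (R - r0)) ^ m < q"
    have absorb: "x \<le> ennreal q * y + ennreal e"
      if "x \<le> ennreal c * y + z" "c < q" "z \<le> ennreal e" for x y z c
      using that by (meson add_mono ennreal_leI less_imp_le mult_right_mono order_trans zero_le)
    show "S r \<le> ennreal q * S r0 + ennreal e \<and> S r0 \<le> ennreal q * S r + ennreal e"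
    proof (cases "r0 \<le> r")
      case True
      then show ?thesis
        using absorb[OF _ ratio(1), of "S r" "S r0" 0] outward[of r0 r]
          absorb[OF inward ratio(3)] small[of r0] r h assms(3) by (simp add: R_def)
    next
      case False
      then show ?thesis
        using absorb[OF _ ratio(2), of "S r0" "S r" 0] outward[of r r0]
          absorb[OF inward ratio(4)] small[of r] r h assms(3) by (simp add: R_def)
    qed
  qed
qed

end
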